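(* Let $\Omega\subset\mathbb{R}^3$ be a bounded smooth domain and $\Gamma\in\mathcal{H}_N(\Omega)$. If $|\Gamma|^2|_{\partial\Omega}=c$ for some constant $c\in[0,\infty)$, then $\Gamma=0$ throughout $\Omega$.
   Context: $\mathcal{H}_N(\Omega)=\{\Gamma\in H^1(\Omega,\mathbb{R}^3)\mid\operatorname{curl}(\Gamma)=0,\ \operatorname{div}(\Gamma)=0,\ \mathcal{N}\cdot\Gamma=0\text{ on }\partial\Omega\}$ is the space of harmonic Neumann fields, where $\mathcal{N}$ is the outward unit normal on $\partial\Omega$; its elements are smooth up to the boundary. A domain is a connected open set; the boundary need not be connected, but the constant $c$ is the same on all connected components of $\partial\Omega$. *)

theory Defs
  imports "HOL-Analysis.Analysis"
begin

primrec continuously_differentiable_on ::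
  "nat \<Rightarrow> ('a::real_normed_vector) set \<Rightarrow> ('a \<Rightarrow> 'b::real_normed_vector) \<Rightarrow> bool" where
  "continuously_differentiable_on 0 S f \<longleftrightarrow> continuous_on S f"
| "continuously_differentiable_on (Suc k) S f \<longleftrightarrow>
     (\<forall>x\<in>S. f differentiable (at x)) \<and>
     (\<forall>v. continuously_differentiable_on k S (\<lambda>x. frechet_derivative f (at x) v))"

text \<open>Intended for open \<open>S\<close> only, since \<open>at x\<close> is not relativised to \<open>S\<close>.\<close>

definition smooth_on :: "('a::real_normed_vector) set \<Rightarrow> ('a \<Rightarrow> 'b::real_normed_vector) \<Rightarrow> bool" where
  "smooth_on S f \<longleftrightarrow> (\<forall>k. continuously_differentiable_on k S f)"

definition partial_deriv :: "3 \<Rightarrow> (real^3 \<Rightarrow> real) \<Rightarrow> real^3 \<Rightarrow> real" where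
  "partial_deriv j f x = frechet_derivative f (at x) (axis j 1)"

definition grad :: "(real^3 \<Rightarrow> real) \<Rightarrow> real^3 \<Rightarrow> real^3" where
  "grad f x = (\<chi> j. partial_deriv j f x)"


subsection \<open>Smooth domains\<close>

text \<open>For open \<open>\<Omega>\<close> these conditions force \<open>frontier \<Omega> \<inter> U = {x \<in> U. \<rho> x = 0}\<close>,
  so the boundary is a smooth hypersurface with \<open>\<Omega>\<close> locally on one side of it, and
  \<open>grad \<rho>\<close> points out of \<open>\<Omega>\<close>.\<close>

definition local_defining_function ::
  "(real^3) set \<Rightarrow> real^3 \<Rightarrow> (real^3) set \<Rightarrow> (real^3 \<Rightarrow> real) \<Rightarrow> bool" where
  "local_defining_function \<Omega> p U \<rho> \<longleftrightarrow>
     open U \<and> p \<in> U \<and> smooth_on U \<rho> \<and> (\<forall>x\<in>U. grad \<rho> x \<noteq> 0) \<and>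
     \<Omega> \<inter> U = {x \<in> U. \<rho> x < 0}"

definition smooth_domain :: "(real^3) set \<Rightarrow> bool" where
  "smooth_domain \<Omega> \<longleftrightarrow>
     open \<Omega> \<and> connected \<Omega> \<and> (\<forall>p\<in>frontier \<Omega>. \<exists>U \<rho>. local_defining_function \<Omega> p U \<rho>)"

definition outward_unit_normal :: "(real^3) set \<Rightarrow> real^3 \<Rightarrow> real^3 \<Rightarrow> bool" where
  "outward_unit_normal \<Omega> p \<nu> \<longleftrightarrow>
     (\<exists>U \<rho>. local_defining_function \<Omega> p U \<rho> \<and> \<nu> = grad \<rho> p /\<^sub>R norm (grad \<rho> p))"


subsection \<open>Sobolev vector fields\<close>

definition test_functions :: "(real^3) set \<Rightarrow> (real^3 \<Rightarrow> real) set" where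
  "test_functions \<Omega> = {\<phi>. smooth_on UNIV \<phi> \<and>
     compact (closure {x. \<phi> x \<noteq> 0}) \<and> closure {x. \<phi> x \<noteq> 0} \<subseteq> \<Omega>}"

definition square_integrable_on :: "(real^3 \<Rightarrow> 'b::euclidean_space) \<Rightarrow> (real^3) set \<Rightarrow> bool" where
  "square_integrable_on f \<Omega> \<longleftrightarrow> f \<in> borel_measurable (lebesgue_on \<Omega>) \<and>
     integrable (lebesgue_on \<Omega>) (\<lambda>x. (norm (f x))\<^sup>2)"

text \<open>The entry \<open>D x $ i $ j\<close> is the weak derivative of the \<open>i\<close>-th component of \<open>\<Gamma>\<close>
  in direction \<open>j\<close>.\<close>

definition has_weak_jacobian ::
  "(real^3) set \<Rightarrow> (real^3 \<Rightarrow> real^3) \<Rightarrow> (real^3 \<Rightarrow> real^3^3) \<Rightarrow> bool" where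
  "has_weak_jacobian \<Omega> \<Gamma> D \<longleftrightarrow>
     square_integrable_on \<Gamma> \<Omega> \<and> square_integrable_on D \<Omega> \<and>
     (\<forall>\<phi>\<in>test_functions \<Omega>. \<forall>i j.
        (\<integral>x. \<Gamma> x $ i * partial_deriv j \<phi> x \<partial>lebesgue_on \<Omega>) =
        - (\<integral>x. D x $ i $ j * \<phi> x \<partial>lebesgue_on \<Omega>))"

definition H1 :: "(real^3) set \<Rightarrow> (real^3 \<Rightarrow> real^3) set" where
  "H1 \<Omega> = {\<Gamma>. \<exists>D. has_weak_jacobian \<Omega> \<Gamma> D}"

text \<open>In \<open>curl_vanishes\<close> and \<open>div_vanishes\<close> the weak Jacobian is unique almost everywhere, so
  for fields in \<open>H1 \<Omega>\<close> the quantifier over \<open>D\<close> merely selects it.\<close>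

definition jacobian_curl :: "real^3^3 \<Rightarrow> real^3" where
  "jacobian_curl A = vector [A$3$2 - A$2$3, A$1$3 - A$3$1, A$2$1 - A$1$2]"

definition curl_vanishes :: "(real^3) set \<Rightarrow> (real^3 \<Rightarrow> real^3) \<Rightarrow> bool" where
  "curl_vanishes \<Omega> \<Gamma> \<longleftrightarrow>
     (\<forall>D. has_weak_jacobian \<Omega> \<Gamma> D \<longrightarrow> (AE x in lebesgue_on \<Omega>. jacobian_curl (D x) = 0))"

definition div_vanishes :: "(real^3) set \<Rightarrow> (real^3 \<Rightarrow> real^3) \<Rightarrow> bool" where
  "div_vanishes \<Omega> \<Gamma> \<longleftrightarrow>
     (\<forall>D. has_weak_jacobian \<Omega> \<Gamma> D \<longrightarrow> (AE x in lebesgue_on \<Omega>. trace (D x) = 0))"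


subsection \<open>Harmonic Neumann fields\<close>

text \<open>Elements of the Sobolev space are classes modulo null sets.  By elliptic regularity each
  harmonic Neumann field has a (unique) representative that is smooth up to the boundary, and
  the field is identified with that representative, so that its boundary values are pointwise
  ones.  Only the continuity of the representative on \<open>closure \<Omega>\<close> is demanded: this pins it down
  and makes its restriction to the boundary agree with the Sobolev trace; smoothness is then a
  consequence and not part of the definition.\<close>

definition harmonic_neumann_fields :: "(real^3) set \<Rightarrow> (real^3 \<Rightarrow> real^3) set" where
  "harmonic_neumann_fields \<Omega> = {\<Gamma> \<in> H1 \<Omega>.
     continuous_on (closure \<Omega>) \<Gamma> \<and>
     curl_vanishes \<Omega> \<Gamma> \<and> div_vanishes \<Omega> \<Gamma> \<and>
     (\<forall>x\<in>frontier \<Omega>. \<forall>\<nu>. outward_unit_normal \<Omega> x \<nu> \<longrightarrow> \<nu> \<bullet> \<Gamma> x = 0)}"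

end

theory Submission
  imports Defs
begin

text \<open>
  The proof compares two estimates of \<open>\<integral>\<^sub>\<Omega> |\<Gamma>|\<^sup>2\<close>.

  \<^item> \<^emph>\<open>Pohozaev identity.\<close> For a constant vector \<open>a\<close> the field
    \<open>X = (|\<Gamma>|\<^sup>2/2 - c/2) a - (\<Gamma> \<bullet> a) \<Gamma>\<close> is divergence-free, because \<open>\<Gamma>\<close> has neither curl nor
    divergence, and on the boundary its normal component vanishes: there \<open>|\<Gamma>|\<^sup>2 = c\<close>, and \<open>\<Gamma>\<close>
    is tangential. Integrating \<open>X\<close> against the gradient of \<open>x \<mapsto> a \<bullet> x\<close> therefore gives
    \<open>\<integral>\<^sub>\<Omega> X \<bullet> a = 0\<close>. Summing over an orthonormal basis yields \<open>\<integral>\<^sub>\<Omega> (|\<Gamma>|\<^sup>2 - 3 c) = 0\<close>.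
  \<^item> \<^emph>\<open>Maximum principle.\<close> Each component \<open>e \<bullet> \<Gamma>\<close> is harmonic, so \<open>|\<Gamma>|\<^sup>2 \<le> c\<close> in \<open>\<Omega>\<close>
    (\<open>harmonic_field_norm_le_boundary\<close>).

  Together \<open>3 c |\<Omega>| \<le> c |\<Omega>|\<close>, so \<open>c = 0\<close>, and the maximum principle makes \<open>\<Gamma>\<close> vanish.

  Elliptic regularity is replaced by mollification: \<open>\<Gamma>\<close> is continuous on the closure and satisfies
  the distributional equations \<open>weakly_curl_div_free\<close>, so convolution with a smooth
  kernel produces smooth fields that satisfy both equations at a fixed distance from the
  boundary and approximate \<open>\<Gamma>\<close> uniformly there. Both the maximum principle and the identity
  \<open>div X = 0\<close> are checked on these and passed to the limit.

  Surface integrals are avoided as well. The boundary condition for \<open>X\<close> is exploited in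
  \<open>divergence_free_up_to_boundary\<close>: multiply a test function by a cut-off that is a function of
  a local defining function \<open>\<rho>\<close> and descends to zero in the layer \<open>-2/n \<le> \<rho> \<le> -1/n\<close>. The error
  term contains \<open>X \<bullet> grad \<rho>\<close>, which is uniformly small in the layer, multiplied by a factor
  whose \<open>L\<^sup>1\<close> norm stays bounded (\<open>layer_integral_bounded\<close>). A smooth decomposition of the test
  function along a finite cover of the closure makes the local statement global.
\<close>

section \<open>A flat function and a smooth step\<close>

text \<open>Dividing \<open>exp (-1/t)\<close> by all powers of \<open>t\<close> gives a family whose derivatives are linear
  combinations of its members, so that no formula for higher derivatives is ever needed.\<close>

definition flat_exp :: "nat \<Rightarrow> real \<Rightarrow> real" where
  "flat_exp m t = (if t \<le> 0 then 0 else exp (- 1 / t) / t ^ m)"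

lemma flat_exp_tendsto_0: "(flat_exp m \<longlongrightarrow> 0) (at_right 0)"
proof -
  have "((\<lambda>t::real. inverse t ^ m / exp (inverse t)) \<longlongrightarrow> 0) (at_right 0)"
    using filterlim_compose[OF tendsto_power_div_exp_0 filterlim_inverse_at_top_right] .
  moreover have "eventually (\<lambda>t::real. inverse t ^ m / exp (inverse t) = flat_exp m t) (at_right 0)"
    using eventually_at_right_less[of 0]
    by eventually_elim (simp add: flat_exp_def exp_minus field_simps)
  ultimately show ?thesis by (rule Lim_transform_eventually)
qed

lemma flat_exp_nonneg: "0 \<le> flat_exp m t"
  by (simp add: flat_exp_def)

lemma flat_exp_pos: "t > 0 \<Longrightarrow> 0 < flat_exp m t"
  by (simp add: flat_exp_def)

lemma flat_exp_eq_0: "t \<le> 0 \<Longrightarrow> flat_exp m t = 0"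
  by (simp add: flat_exp_def)

lemma DERIV_flat_exp:
  "(flat_exp m has_real_derivative flat_exp (m + 2) t - real m * flat_exp (m + 1) t) (at t)"
proof -
  consider "t > 0" | "t < 0" | "t = 0" by linarith
  then show ?thesis
  proof cases
    case 1
    have "((\<lambda>t. exp (- 1 / t) / t ^ m) has_real_derivative
        flat_exp (m + 2) t - real m * flat_exp (m + 1) t) (at t)"
      using 1
      apply (auto intro!: derivative_eq_intros simp: flat_exp_def)
      apply (cases m)
      apply (auto simp: field_simps power2_eq_square)
      done
    then show ?thesis
      by (rule has_field_derivative_transform_within_open[of _ _ _ "{0<..}"])
        (use 1 in \<open>auto simp: flat_exp_def\<close>)
  next
    case 2
    have "((\<lambda>t::real. 0) has_real_derivative flat_exp (m + 2) t - real m * flat_exp (m + 1) t) (at t)"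
      using 2 by (simp add: flat_exp_def)
    then show ?thesis
      by (rule has_field_derivative_transform_within_open[of _ _ _ "{..<0}"])
        (use 2 in \<open>auto simp: flat_exp_def\<close>)
  next
    case 3
    have "((\<lambda>h. flat_exp m h / h) \<longlongrightarrow> 0) (at_left 0)"
      by (rule Lim_transform_eventually[of "\<lambda>_. 0"])
        (auto simp: flat_exp_def eventually_at_filter)
    moreover have "((\<lambda>h. flat_exp m h / h) \<longlongrightarrow> 0) (at_right 0)"
      by (rule Lim_transform_eventually[OF flat_exp_tendsto_0[of "m + 1"]])
        (auto simp: flat_exp_def eventually_at_filter)
    ultimately have "((\<lambda>h. flat_exp m h / h) \<longlongrightarrow> 0) (at 0)"
      by (rule filterlim_split_at)
    then show ?thesis using 3 by (simp add: DERIV_def flat_exp_def)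
  qed
qed

lemma continuous_flat_exp [continuous_intros]:
  "continuous_on S f \<Longrightarrow> continuous_on S (\<lambda>x. flat_exp m (f x))"
  using continuous_on_compose2[of UNIV "flat_exp m" S f]
  by (meson DERIV_flat_exp DERIV_continuous continuous_at_imp_continuous_on top_greatest UNIV_I)

definition smooth_step :: "real \<Rightarrow> real" where
  "smooth_step t = flat_exp 0 t / (flat_exp 0 t + flat_exp 0 (1 - t))"

definition smooth_step' :: "real \<Rightarrow> real" where
  "smooth_step' t = (flat_exp 2 t * flat_exp 0 (1 - t) + flat_exp 0 t * flat_exp 2 (1 - t)) /
     (flat_exp 0 t + flat_exp 0 (1 - t))\<^sup>2"

lemma smooth_step_denominator: "flat_exp 0 t + flat_exp 0 (1 - t) > 0"
  using flat_exp_nonneg[of 0 t] flat_exp_nonneg[of 0 "1 - t"] flat_exp_pos[of t 0] flat_exp_pos[of "1 - t" 0]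
  by (cases "t > 0") auto

lemma DERIV_smooth_step: "(smooth_step has_real_derivative smooth_step' t) (at t)"
proof -
  have 1: "(flat_exp 0 has_real_derivative flat_exp 2 t) (at t)" for t
    using DERIV_flat_exp[of 0 t] by (simp add: numeral_2_eq_2)
  have 2: "((\<lambda>t. flat_exp 0 (1 - t)) has_real_derivative flat_exp 2 (1 - t) * - 1) (at t)"
    by (rule DERIV_chain2[of "flat_exp 0", OF 1]) (auto intro!: derivative_eq_intros)
  show ?thesis
    unfolding smooth_step_def[abs_def]
    by (rule DERIV_cong[OF DERIV_divide[OF 1 DERIV_add[OF 1 2]]])
      (use smooth_step_denominator[of t] in \<open>auto simp: smooth_step'_def power2_eq_square algebra_simps\<close>)
qed

lemma continuous_smooth_step': "continuous_on UNIV smooth_step'"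
  unfolding smooth_step'_def[abs_def]
  by (intro continuous_intros ballI) (metis smooth_step_denominator less_irrefl power_eq_0_iff)

lemma smooth_step_bounds: "0 \<le> smooth_step t" "smooth_step t \<le> 1"
  using smooth_step_denominator[of t] flat_exp_nonneg[of 0 t] flat_exp_nonneg[of 0 "1 - t"]
  by (auto simp: smooth_step_def divide_le_eq)

lemma smooth_step'_nonneg: "0 \<le> smooth_step' t"
  by (auto simp: smooth_step'_def intro!: divide_nonneg_nonneg add_nonneg_nonneg mult_nonneg_nonneg flat_exp_nonneg)

lemma smooth_step_eq:
  "t \<le> 0 \<Longrightarrow> smooth_step t = 0" "1 \<le> t \<Longrightarrow> smooth_step t = 1"
  using smooth_step_denominator[of t] by (auto simp: smooth_step_def flat_exp_eq_0)

lemma smooth_step'_eq_0: "t \<le> 0 \<or> 1 \<le> t \<Longrightarrow> smooth_step' t = 0"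
  by (auto simp: smooth_step'_def flat_exp_eq_0)

section \<open>Functions with a continuous gradient\<close>

text \<open>Carrying the gradient as an explicit vector field, instead of recovering it from the Frechet
  derivative, turns the product and chain rules into identities between vector fields.\<close>

definition C1_on :: "'a::euclidean_space set \<Rightarrow> ('a \<Rightarrow> real) \<Rightarrow> ('a \<Rightarrow> 'a) \<Rightarrow> bool" where
  "C1_on V f g \<longleftrightarrow> (\<forall>x\<in>V. (f has_derivative (\<lambda>v. g x \<bullet> v)) (at x)) \<and> continuous_on V g"

lemma C1_onD: "C1_on V f g \<Longrightarrow> x \<in> V \<Longrightarrow> (f has_derivative (\<lambda>v. g x \<bullet> v)) (at x)"
  by (simp add: C1_on_def)

lemma C1_on_continuous: "C1_on V f g \<Longrightarrow> continuous_on V f"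
  by (meson C1_onD continuous_at_imp_continuous_on has_derivative_continuous)

lemma C1_on_continuous_gradient: "C1_on V f g \<Longrightarrow> continuous_on V g"
  by (simp add: C1_on_def)

lemma C1_on_subset: "C1_on V f g \<Longrightarrow> W \<subseteq> V \<Longrightarrow> C1_on W f g"
  by (auto simp: C1_on_def intro: continuous_on_subset)

lemma C1_on_inner: "C1_on V (\<lambda>x. a \<bullet> x) (\<lambda>x. a)"
  by (auto simp: C1_on_def intro!: derivative_eq_intros)

lemma C1_on_const: "C1_on V (\<lambda>x. c) (\<lambda>x. 0)"
  by (auto simp: C1_on_def)

lemma C1_on_norm_squared_diff: "C1_on V (\<lambda>x. (norm (x - p))\<^sup>2) (\<lambda>x. 2 *\<^sub>R (x - p))"
  unfolding C1_on_def power2_norm_eq_inner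
  by (auto intro!: derivative_eq_intros continuous_intros simp: inner_commute algebra_simps)

lemma C1_on_mult:
  assumes "C1_on V f g" "C1_on V f' g'"
  shows "C1_on V (\<lambda>x. f x * f' x) (\<lambda>x. f x *\<^sub>R g' x + f' x *\<^sub>R g x)"
  unfolding C1_on_def
proof (intro conjI ballI)
  show "continuous_on V (\<lambda>x. f x *\<^sub>R g' x + f' x *\<^sub>R g x)"
    using assms C1_on_continuous C1_on_continuous_gradient by (intro continuous_intros) auto
  fix x assume "x \<in> V"
  show "((\<lambda>x. f x * f' x) has_derivative (\<lambda>v. (f x *\<^sub>R g' x + f' x *\<^sub>R g x) \<bullet> v)) (at x)"
    by (rule has_derivative_eq_rhs[OF has_derivative_mult[OF C1_onD[OF assms(1) \<open>x \<in> V\<close>] C1_onD[OF assms(2) \<open>x \<in> V\<close>]]])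
      (simp add: inner_left_distrib algebra_simps)
qed

lemma C1_on_add:
  assumes "C1_on V f g" "C1_on V f' g'"
  shows "C1_on V (\<lambda>x. f x + f' x) (\<lambda>x. g x + g' x)"
  using assms unfolding C1_on_def
  by (auto intro!: continuous_intros derivative_eq_intros simp: inner_left_distrib)

lemma C1_on_sum:
  assumes "\<And>i. i \<in> I \<Longrightarrow> C1_on V (f i) (g i)"
  shows "C1_on V (\<lambda>x. \<Sum>i\<in>I. f i x) (\<lambda>x. \<Sum>i\<in>I. g i x)"
  using assms unfolding C1_on_def
  by (auto intro!: continuous_intros derivative_eq_intros simp: inner_sum_left)

lemma C1_on_compose:
  assumes "C1_on V f g" "\<And>t. (s has_real_derivative s' t) (at t)" "continuous_on UNIV s'"
  shows "C1_on V (\<lambda>x. s (f x)) (\<lambda>x. s' (f x) *\<^sub>R g x)"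
  unfolding C1_on_def
proof (intro conjI ballI)
  show "continuous_on V (\<lambda>x. s' (f x) *\<^sub>R g x)"
    using assms C1_on_continuous C1_on_continuous_gradient
    by (intro continuous_intros continuous_on_compose2[OF assms(3)]) auto
  fix x assume "x \<in> V"
  show "((\<lambda>x. s (f x)) has_derivative (\<lambda>v. (s' (f x) *\<^sub>R g x) \<bullet> v)) (at x)"
    using has_derivative_compose[OF C1_onD[OF assms(1) \<open>x \<in> V\<close>] assms(2)[of "f x", unfolded has_field_derivative_def]]
    by simp
qed

lemma C1_on_gradient_unique:
  assumes "C1_on V f g" "C1_on W f' g'" "open S" "x \<in> S" "S \<subseteq> V" "S \<subseteq> W" "\<And>y. y \<in> S \<Longrightarrow> f y = f' y"
  shows "g x = g' x"
proof -
  have 1: "(f has_derivative (\<lambda>v. g x \<bullet> v)) (at x)" using assms C1_onD by blast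
  have "(f' has_derivative (\<lambda>v. g' x \<bullet> v)) (at x)" using assms C1_onD by blast
  then have "(f has_derivative (\<lambda>v. g' x \<bullet> v)) (at x)"
    by (rule has_derivative_transform_within_open[OF _ assms(3,4)]) (use assms in auto)
  from has_derivative_unique[OF 1 this] have "g x \<bullet> v = g' x \<bullet> v" for v by meson
  then show ?thesis by (metis vector_eq_rdot)
qed

lemma C1_on_gradient_eq_0:
  assumes "C1_on V f g" "open S" "x \<in> S" "S \<subseteq> V" "\<And>y. y \<in> S \<Longrightarrow> f y = 0"
  shows "g x = 0"
  using C1_on_gradient_unique[OF assms(1) C1_on_const[of UNIV 0] assms(2,3,4)] assms(5) by auto

text \<open>The cut-offs below are differentiable only near a piece of the boundary. Multiplying by a
  function supported there gives a global function, whatever values the cut-off takes elsewhere.\<close>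

lemma C1_on_mult_local:
  assumes f: "C1_on UNIV f g" and S: "closed S" "S \<subseteq> V" "open V" and f0: "\<And>x. x \<notin> S \<Longrightarrow> f x = 0"
    and h: "C1_on V h k"
  shows "C1_on UNIV (\<lambda>x. f x * h x) (\<lambda>x. f x *\<^sub>R k x + h x *\<^sub>R g x)"
proof -
  have g0: "g x = 0" if "x \<notin> S" for x
    using C1_on_gradient_eq_0[OF f, of "- S"] that S f0 by auto
  have 1: "C1_on V (\<lambda>x. f x * h x) (\<lambda>x. f x *\<^sub>R k x + h x *\<^sub>R g x)"
    by (rule C1_on_mult[OF C1_on_subset[OF f] h]) simp
  have "continuous_on (- S) (\<lambda>x. f x *\<^sub>R k x + h x *\<^sub>R g x) \<longleftrightarrow> continuous_on (- S) (\<lambda>x. 0::'a)"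
    by (rule continuous_on_cong) (use g0 f0 in auto)
  then have c: "continuous_on (- S) (\<lambda>x. f x *\<^sub>R k x + h x *\<^sub>R g x)" by simp
  have un: "V \<union> - S = UNIV" using S by auto
  show ?thesis
    unfolding C1_on_def
  proof (intro conjI ballI)
    show "continuous_on UNIV (\<lambda>x. f x *\<^sub>R k x + h x *\<^sub>R g x)"
      using continuous_on_open_Un[OF S(3) open_Compl[OF S(1)] C1_on_continuous_gradient[OF 1] c] un by simp
    fix x
    show "((\<lambda>x. f x * h x) has_derivative (\<lambda>v. (f x *\<^sub>R k x + h x *\<^sub>R g x) \<bullet> v)) (at x)"
    proof (cases "x \<in> S")
      case True then show ?thesis using C1_onD[OF 1] S by blast
    next
      case False
      have "((\<lambda>x. 0) has_derivative (\<lambda>v. (f x *\<^sub>R k x + h x *\<^sub>R g x) \<bullet> v)) (at x)"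
        using False g0 f0 by simp
      then show ?thesis
        by (rule has_derivative_transform_within_open[of _ _ _ _ "- S"]) (use S False f0 in auto)
    qed
  qed
qed

lemma C1_on_bump:
  fixes p :: "'a::euclidean_space"
  assumes "r > 0"
  obtains b g where "C1_on UNIV b g" "\<And>x. 0 \<le> b x" "\<And>x. x \<in> cball p r \<Longrightarrow> b x = 1"
    "\<And>x. x \<notin> cball p (2 * r) \<Longrightarrow> b x = 0"
proof
  let ?f = "\<lambda>x. 2 + (-1 / r\<^sup>2) * (norm (x - p))\<^sup>2"
  show "C1_on UNIV (\<lambda>x. smooth_step (?f x)) (\<lambda>x. smooth_step' (?f x) *\<^sub>R
     (0 + ((-1 / r\<^sup>2) *\<^sub>R (2 *\<^sub>R (x - p)) + (norm (x - p))\<^sup>2 *\<^sub>R 0)))"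
    by (rule C1_on_compose[OF _ DERIV_smooth_step continuous_smooth_step'] C1_on_add C1_on_mult
      C1_on_const C1_on_norm_squared_diff)+
  show "0 \<le> smooth_step (?f x)" for x by (rule smooth_step_bounds)
  show "smooth_step (?f x) = 1" if "x \<in> cball p r" for x
  proof -
    have "(norm (x - p))\<^sup>2 \<le> r\<^sup>2" using that by (intro power_mono) (auto simp: dist_norm norm_minus_commute)
    then show ?thesis using assms by (intro smooth_step_eq) (simp add: field_simps)
  qed
  show "smooth_step (?f x) = 0" if "x \<notin> cball p (2 * r)" for x
  proof -
    have "(2 * r)\<^sup>2 \<le> (norm (x - p))\<^sup>2"
      using that assms by (intro power_mono) (auto simp: dist_norm norm_minus_commute)
    then have "2 * r\<^sup>2 \<le> (norm (x - p))\<^sup>2" by (simp add: power_mult_distrib) (smt (verit) zero_le_power2)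
    then show ?thesis using assms by (intro smooth_step_eq) (simp add: field_simps)
  qed
qed

section \<open>Integrals of gradients and convolutions\<close>

lemma compact_support_uniformly_continuous:
  fixes g :: "'a::euclidean_space \<Rightarrow> 'b::real_normed_vector"
  assumes "continuous_on UNIV g" "compact S" and g0: "\<And>x. x \<notin> S \<Longrightarrow> g x = 0"
  shows "uniformly_continuous_on UNIV g"
proof -
  obtain R where R: "\<And>x. x \<in> S \<Longrightarrow> norm x \<le> R"
    using compact_imp_bounded[OF assms(2)] by (auto simp: bounded_iff)
  have "uniformly_continuous_on (cball 0 (R + 1)) g"
    by (rule compact_uniformly_continuous) (use assms in \<open>auto intro: continuous_on_subset\<close>)
  show ?thesis
    unfolding uniformly_continuous_on_def
  proof safe
    fix e :: real assume "e > 0"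
    with \<open>uniformly_continuous_on (cball 0 (R + 1)) g\<close> obtain d where "d > 0" and
      d: "\<And>x x'. x \<in> cball 0 (R + 1) \<Longrightarrow> x' \<in> cball 0 (R + 1) \<Longrightarrow> dist x' x < d \<Longrightarrow> dist (g x') (g x) < e"
      unfolding uniformly_continuous_on_def by metis
    show "\<exists>d>0. \<forall>x\<in>UNIV. \<forall>x'\<in>UNIV. dist x' x < d \<longrightarrow> dist (g x') (g x) < e"
    proof (intro exI[of _ "min d 1"] conjI ballI impI)
      show "min d 1 > 0" using \<open>d > 0\<close> by simp
      fix x x' :: 'a assume dd: "dist x' x < min d 1"
      show "dist (g x') (g x) < e"
      proof (cases "x \<in> cball 0 (R + 1) \<and> x' \<in> cball 0 (R + 1)")
        case True then show ?thesis using d dd by simp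
      next
        case False
        have "norm x \<le> norm x' + dist x' x" "norm x' \<le> norm x + dist x' x"
          using norm_triangle_ineq2[of x x'] norm_triangle_ineq2[of x' x]
          by (auto simp: dist_norm norm_minus_commute)
        with False dd have "\<not> norm x \<le> R" "\<not> norm x' \<le> R" by auto
        then have "g x = 0" "g x' = 0" using R g0 by blast+
        then show ?thesis using \<open>e > 0\<close> by simp
      qed
    qed
  qed
qed

lemma compact_support_bounded:
  fixes g :: "'a::euclidean_space \<Rightarrow> 'b::real_normed_vector"
  assumes "continuous_on UNIV g" "compact S" and g0: "\<And>x. x \<notin> S \<Longrightarrow> g x = 0"
  obtains M where "\<And>x. norm (g x) \<le> M"
proof -
  have "bounded (g ` S)"
    by (intro compact_imp_bounded compact_continuous_image) (use assms in \<open>auto intro: continuous_on_subset\<close>)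
  then obtain M where "\<And>x. x \<in> S \<Longrightarrow> norm (g x) \<le> M" by (auto simp: bounded_iff)
  then have "norm (g x) \<le> max M 0" for x using g0[of x] by (cases "x \<in> S") (auto simp: max.coboundedI1)
  then show thesis using that by blast
qed

lemma integrable_continuous_on_support:
  fixes f :: "'a::euclidean_space \<Rightarrow> 'b::{banach, second_countable_topology}"
  assumes "compact S" "continuous_on S f" "\<And>x. x \<notin> S \<Longrightarrow> f x = 0"
  shows "integrable lborel f"
proof -
  have "(\<lambda>x. indicator S x *\<^sub>R f x) = f" using assms(3) by (auto simp: indicator_def fun_eq_iff)
  then show ?thesis using borel_integrable_compact[OF assms(1,2)] by simp
qed

lemma compact_support_integrable:
  fixes g :: "'a::euclidean_space \<Rightarrow> 'b::{banach, second_countable_topology}"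
  assumes "continuous_on UNIV g" "compact S" "\<And>x. x \<notin> S \<Longrightarrow> g x = 0"
  shows "integrable lborel g"
  by (rule integrable_continuous_on_support[OF assms(2) continuous_on_subset[OF assms(1)] assms(3)]) auto

lemma C1_gradient_support:
  assumes "C1_on UNIV f g" "closed S" "\<And>x. x \<notin> S \<Longrightarrow> f x = 0" "x \<notin> S"
  shows "g x = 0"
  using C1_on_gradient_eq_0[OF assms(1), of "- S" x] assms by auto

text \<open>Uniform continuity of a compactly supported gradient makes the first-order Taylor error
  uniform in the base point; differentiation under the integral sign and the vanishing of integrals
  of gradients are both read off from this.\<close>

lemma C1_uniform_linearization:
  fixes f :: "'a::euclidean_space \<Rightarrow> real"
  assumes f: "C1_on UNIV f g" and S: "compact S" "\<And>x. x \<notin> S \<Longrightarrow> f x = 0" and "e > 0"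
  obtains d where "d > 0" "\<And>x h. norm h < d \<Longrightarrow> \<bar>f (x + h) - f x - g x \<bullet> h\<bar> \<le> e * norm h"
proof -
  have "uniformly_continuous_on UNIV g"
    by (rule compact_support_uniformly_continuous[OF C1_on_continuous_gradient[OF f] S(1)])
      (use C1_gradient_support[OF f compact_imp_closed[OF S(1)] S(2)] in auto)
  then obtain d where "d > 0" and d: "\<And>x x'. dist x' x < d \<Longrightarrow> dist (g x') (g x) < e"
    using \<open>e > 0\<close> unfolding uniformly_continuous_on_def by (metis UNIV_I)
  show thesis
  proof (rule that[OF \<open>d > 0\<close>])
    fix x h :: 'a assume h: "norm h < d"
    have "norm (f (x + h) - f x - g x \<bullet> (x + h - x)) \<le> norm (x + h - x) * e"
    proof (rule differentiable_bound_linearization[where S = "cball x (norm h)" and f' = "\<lambda>x v. g x \<bullet> v"])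
      show "x + t *\<^sub>R (x + h - x) \<in> cball x (norm h)" if "t \<in> {0..1}" for t
        using that mult_left_le_one_le[of "norm h" t] by (auto simp: dist_norm)
      show "(f has_derivative (\<lambda>v. g y \<bullet> v)) (at y within cball x (norm h))" for y
        using C1_onD[OF f] by (auto intro: has_derivative_at_withinI)
      show "onorm ((\<lambda>v. g y \<bullet> v) - (\<lambda>v. g x \<bullet> v)) \<le> e" if "y \<in> cball x (norm h)" for y
      proof (rule onorm_le)
        fix v :: 'a
        have "dist (g y) (g x) < e" using that h by (intro d) (auto simp: dist_commute)
        then have "norm (g y - g x) * norm v \<le> e * norm v"
          by (intro mult_right_mono) (auto simp: dist_norm)
        then show "norm (((\<lambda>v. g y \<bullet> v) - (\<lambda>v. g x \<bullet> v)) v) \<le> e * norm v"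
          using Cauchy_Schwarz_ineq2[of "g y - g x" v] by (simp add: inner_diff_left)
      qed
    qed simp
    then show "\<bar>f (x + h) - f x - g x \<bullet> h\<bar> \<le> e * norm h" by (simp add: mult.commute)
  qed
qed

lemma lborel_integral_translate:
  fixes f :: "'a::euclidean_space \<Rightarrow> 'b::{banach, second_countable_topology}"
  assumes "f \<in> borel_measurable borel"
  shows "(\<integral>x. f (x + h) \<partial>lborel) = (\<integral>x. f x \<partial>lborel)"
proof -
  have "(\<integral>x. f x \<partial>lborel) = (\<integral>x. f x \<partial>distr lborel borel ((+) h))"
    by (simp add: lborel_distr_plus)
  also have "\<dots> = (\<integral>x. f (h + x) \<partial>lborel)"
    by (rule integral_distr) (use assms in auto)
  finally show ?thesis by (simp add: add.commute)
qed

text \<open>Translation invariance: \<open>\<integral> f (x + t v) - f x\<close> vanishes for all \<open>t\<close>, while to first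
  order it equals \<open>t \<integral> g \<bullet> v\<close>. All later integrations by parts
  reduce to this.\<close>

lemma integral_gradient_eq_0:
  fixes f :: "'a::euclidean_space \<Rightarrow> real"
  assumes f: "C1_on UNIV f g" and S: "compact S" "\<And>x. x \<notin> S \<Longrightarrow> f x = 0"
  shows "(\<integral>x. g x \<bullet> v \<partial>lborel) = 0"
proof (rule ccontr)
  assume ne: "(\<integral>x. g x \<bullet> v \<partial>lborel) \<noteq> 0"
  then have v: "v \<noteq> 0" by auto
  define I where "I = (\<integral>x. g x \<bullet> v \<partial>lborel)"
  obtain R where R: "\<And>x. x \<in> S \<Longrightarrow> norm x \<le> R"
    using compact_imp_bounded[OF S(1)] by (auto simp: bounded_iff)
  define B :: "'a set" where "B = cball 0 (R + 1)"
  define m where "m = measure lborel B"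
  have m: "m \<ge> 0" by (simp add: m_def)
  have fi: "integrable lborel f"
    by (rule compact_support_integrable[OF C1_on_continuous[OF f] S])
  have g0: "x \<notin> S \<Longrightarrow> g x = 0" for x
    using C1_gradient_support[OF f compact_imp_closed[OF S(1)] S(2)] by blast
  have gi: "integrable lborel (\<lambda>x. g x \<bullet> v)"
    by (rule compact_support_integrable[OF _ S(1)])
      (use C1_on_continuous_gradient[OF f] g0 in \<open>auto intro!: continuous_intros\<close>)
  define e where "e = \<bar>I\<bar> / (2 * norm v * (m + 1))"
  have "e > 0" using ne v m by (simp add: e_def I_def)
  then obtain d where "d > 0" and
    d: "\<And>x h. norm h < d \<Longrightarrow> \<bar>f (x + h) - f x - g x \<bullet> h\<bar> \<le> e * norm h"
    using C1_uniform_linearization[OF f S, of e] by blast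
  \<comment> \<open>short enough for the linearization and for keeping translated supports inside \<open>B\<close>\<close>
  define t where "t = min d 1 / (2 * norm v)"
  have t: "t > 0" "norm (t *\<^sub>R v) < d" "norm (t *\<^sub>R v) < 1"
    using \<open>d > 0\<close> v by (auto simp: t_def min_def)
  have fm: "f \<in> borel_measurable borel"
    using C1_on_continuous[OF f] by (rule borel_measurable_continuous_onI)
  have ti: "integrable lborel (\<lambda>x. f (x + t *\<^sub>R v))"
  proof (rule compact_support_integrable[of _ B])
    show "continuous_on UNIV (\<lambda>x. f (x + t *\<^sub>R v))"
      by (rule continuous_on_compose2[OF C1_on_continuous[OF f]]) (auto intro!: continuous_intros)
    show "compact B" by (simp add: B_def)
    show "f (x + t *\<^sub>R v) = 0" if "x \<notin> B" for x
    proof (rule S(2), rule notI)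
      assume "x + t *\<^sub>R v \<in> S"
      then have "norm (x + t *\<^sub>R v) \<le> R" by (rule R)
      then show False using that t(3) norm_triangle_ineq4[of "x + t *\<^sub>R v" "t *\<^sub>R v"] by (simp add: B_def)
    qed
  qed
  have bd: "\<bar>f (x + t *\<^sub>R v) - f x - t * (g x \<bullet> v)\<bar> \<le> e * norm (t *\<^sub>R v) * indicator B x" for x
  proof (cases "x \<in> B")
    case True then show ?thesis using d[OF t(2), of x] by simp
  next
    case False
    have "x \<notin> S" "x + t *\<^sub>R v \<notin> S"
      using False R[of x] R[of "x + t *\<^sub>R v"] t(3) norm_triangle_ineq4[of "x + t *\<^sub>R v" "t *\<^sub>R v"]
      by (auto simp: B_def)
    then show ?thesis using S(2) g0 False by simp
  qed
  have "t * I = - (\<integral>x. f (x + t *\<^sub>R v) - f x - t * (g x \<bullet> v) \<partial>lborel)"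
    using ti fi gi lborel_integral_translate[OF fm, of "t *\<^sub>R v"] by (simp add: I_def)
  then have "\<bar>t * I\<bar> = norm (\<integral>x. f (x + t *\<^sub>R v) - f x - t * (g x \<bullet> v) \<partial>lborel)" by simp
  also have "\<dots> \<le> (\<integral>x. e * norm (t *\<^sub>R v) * indicator B x \<partial>lborel)"
  proof (rule Bochner_Integration.integral_norm_bound_integral)
    show "integrable lborel (\<lambda>x. f (x + t *\<^sub>R v) - f x - t * (g x \<bullet> v))"
      using ti fi gi by auto
    show "integrable lborel (\<lambda>x. e * norm (t *\<^sub>R v) * indicator B x)"
      by (intro integrable_mult_right integrable_real_indicator emeasure_bounded_finite) (auto simp: B_def)
  qed (use bd in simp)
  also have "\<dots> = e * (t * norm v) * m"
    using t by (simp add: m_def B_def)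
  also have "\<dots> < e * (t * norm v) * (2 * (m + 1))"
    using \<open>e > 0\<close> t v m by (intro mult_strict_left_mono) auto
  also have "\<dots> = t * \<bar>I\<bar>" using v m by (simp add: e_def)
  finally show False using t by (simp add: abs_mult)
qed

definition convolution :: "('a::euclidean_space \<Rightarrow> real) \<Rightarrow> ('a \<Rightarrow> real) \<Rightarrow> 'a \<Rightarrow> real" where
  "convolution f w x = (\<integral>y. f (x - y) * w y \<partial>lborel)"

lemma integrable_reflected_scaleR:
  fixes g :: "'a::euclidean_space \<Rightarrow> 'b::{banach, second_countable_topology}" and w :: "'a \<Rightarrow> real"
  assumes "continuous_on UNIV g" "compact S" "\<And>x. x \<notin> S \<Longrightarrow> g x = 0" "integrable lborel w"
  shows "integrable lborel (\<lambda>y. w y *\<^sub>R g (x - y))"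
proof -
  obtain M where M: "\<And>x. norm (g x) \<le> M" using compact_support_bounded assms(1-3) by blast
  have [measurable]: "w \<in> borel_measurable borel" using borel_measurable_integrable[OF assms(4)] by simp
  have "(\<lambda>y. g (x - y)) \<in> borel_measurable borel"
    by (intro borel_measurable_continuous_onI continuous_on_compose2[OF assms(1)])
      (auto intro!: continuous_intros)
  note [measurable] = this
  show ?thesis
  proof (rule Bochner_Integration.integrable_bound)
    show "integrable lborel (\<lambda>y. M * w y)" using assms(4) by simp
    show "AE y in lborel. norm (w y *\<^sub>R g (x - y)) \<le> norm (M * w y)"
    proof (rule AE_I2)
      fix y
      have "norm (g (x - y)) \<le> \<bar>M\<bar>" using M[of "x - y"] by linarith
      then show "norm (w y *\<^sub>R g (x - y)) \<le> norm (M * w y)"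
        by (simp add: abs_mult mult.commute[of "\<bar>M\<bar>"] mult_left_mono)
    qed
  qed measurable
qed

lemma C1_convolution:
  fixes f :: "'a::euclidean_space \<Rightarrow> real"
  assumes f: "C1_on UNIV f g" and S: "compact S" "\<And>x. x \<notin> S \<Longrightarrow> f x = 0" and w: "integrable lborel w"
  shows "C1_on UNIV (convolution f w) (\<lambda>x. \<integral>y. w y *\<^sub>R g (x - y) \<partial>lborel)"
proof -
  have g0: "x \<notin> S \<Longrightarrow> g x = 0" for x
    using C1_gradient_support[OF f compact_imp_closed[OF S(1)] S(2)] by blast
  have gc: "continuous_on UNIV g" by (rule C1_on_continuous_gradient[OF f])
  have fi: "integrable lborel (\<lambda>y. f (x - y) * w y)" for x
    using integrable_reflected_scaleR[OF C1_on_continuous[OF f] S w, of x] by (simp add: mult.commute)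
  have gi: "integrable lborel (\<lambda>y. w y *\<^sub>R g (x - y))" for x
    by (rule integrable_reflected_scaleR[OF gc S(1) g0 w])
  have wi: "integrable lborel (\<lambda>y. c * \<bar>w y\<bar>)" for c using w by simp
  define m where "m = (\<integral>y. \<bar>w y\<bar> \<partial>lborel)"
  have m: "m \<ge> 0" by (simp add: m_def)
  have small: "e / (m + 1) > 0" "e / (m + 1) * m \<le> e" if "e > 0" for e :: real
    using that m by (auto simp: field_simps)
  define G where "G x = (\<integral>y. w y *\<^sub>R g (x - y) \<partial>lborel)" for x
  have Gin: "G x \<bullet> h = (\<integral>y. w y * (g (x - y) \<bullet> h) \<partial>lborel)" and
    Gini: "integrable lborel (\<lambda>y. w y * (g (x - y) \<bullet> h))" for x h
    using gi[of x] by (auto simp: G_def simp flip: inner_scaleR_left)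
  have "(convolution f w has_derivative (\<lambda>v. G x \<bullet> v)) (at x)" for x
    unfolding has_derivative_at_alt
  proof (intro conjI allI impI)
    show "bounded_linear (\<lambda>v. G x \<bullet> v)" by (rule bounded_linear_inner_right)
    fix e :: real assume "e > 0"
    obtain d where "d > 0" and
      d: "\<And>x h. norm h < d \<Longrightarrow> \<bar>f (x + h) - f x - g x \<bullet> h\<bar> \<le> e / (m + 1) * norm h"
      using C1_uniform_linearization[OF f S small(1)[OF \<open>e > 0\<close>]] by blast
    show "\<exists>d>0. \<forall>y. norm (y - x) < d \<longrightarrow>
      norm (convolution f w y - convolution f w x - G x \<bullet> (y - x)) \<le> e * norm (y - x)"
    proof (intro exI[of _ d] conjI allI impI \<open>d > 0\<close>)
      fix z assume z: "norm (z - x) < d"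
      have "convolution f w z - convolution f w x - G x \<bullet> (z - x) =
        (\<integral>y. w y * (f (z - y) - f (x - y) - g (x - y) \<bullet> (z - x)) \<partial>lborel)"
        using fi[of z] fi[of x] Gini[of x "z - x"]
        by (simp add: convolution_def Gin algebra_simps del: inner_diff_right)
      also have "norm \<dots> \<le> (\<integral>y. (e / (m + 1) * norm (z - x)) * \<bar>w y\<bar> \<partial>lborel)"
      proof (rule Bochner_Integration.integral_norm_bound_integral)
        show "integrable lborel (\<lambda>y. w y * (f (z - y) - f (x - y) - g (x - y) \<bullet> (z - x)))"
          using fi[of z] fi[of x] Gini[of x "z - x"] by (simp add: algebra_simps del: inner_diff_right)
        show "norm (w y * (f (z - y) - f (x - y) - g (x - y) \<bullet> (z - x)))
          \<le> (e / (m + 1) * norm (z - x)) * \<bar>w y\<bar>" for y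
          using mult_right_mono[OF d[OF z, of "x - y"], of "\<bar>w y\<bar>"] by (simp add: abs_mult mult.commute)
      qed (rule wi)
      also have "\<dots> = (e / (m + 1) * m) * norm (z - x)" by (simp add: m_def)
      also have "\<dots> \<le> e * norm (z - x)" using small(2)[OF \<open>e > 0\<close>] by (rule mult_right_mono) simp
      finally show "norm (convolution f w z - convolution f w x - G x \<bullet> (z - x)) \<le> e * norm (z - x)" .
    qed
  qed
  moreover have "continuous_on UNIV G"
    unfolding continuous_on_iff
  proof safe
    fix x and e :: real assume "e > 0"
    have "uniformly_continuous_on UNIV g"
      by (rule compact_support_uniformly_continuous[OF gc S(1) g0])
    then obtain d where "d > 0" and d: "\<And>x x'. dist x' x < d \<Longrightarrow> dist (g x') (g x) < e / 2 / (m + 1)"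
      using small(1)[of "e / 2"] \<open>e > 0\<close> unfolding uniformly_continuous_on_def by (metis UNIV_I half_gt_zero)
    show "\<exists>d>0. \<forall>x'\<in>UNIV. dist x' x < d \<longrightarrow> dist (G x') (G x) < e"
    proof (intro exI[of _ d] conjI ballI impI \<open>d > 0\<close>)
      fix z assume z: "dist z x < d"
      have "G z - G x = (\<integral>y. w y *\<^sub>R (g (z - y) - g (x - y)) \<partial>lborel)"
        using gi[of z] gi[of x] by (simp add: G_def scaleR_diff_right)
      also have "norm \<dots> \<le> (\<integral>y. (e / 2 / (m + 1)) * \<bar>w y\<bar> \<partial>lborel)"
      proof (rule Bochner_Integration.integral_norm_bound_integral)
        show "integrable lborel (\<lambda>y. w y *\<^sub>R (g (z - y) - g (x - y)))"
          using gi[of z] gi[of x] by (simp add: scaleR_diff_right)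
        show "norm (w y *\<^sub>R (g (z - y) - g (x - y))) \<le> (e / 2 / (m + 1)) * \<bar>w y\<bar>" for y
          using mult_right_mono[of "norm (g (z - y) - g (x - y))" "e / 2 / (m + 1)" "\<bar>w y\<bar>"]
            d[of "z - y" "x - y"] z by (simp add: dist_norm mult.commute)
      qed (rule wi)
      also have "\<dots> = e / 2 / (m + 1) * m" by (simp add: m_def)
      also have "\<dots> \<le> e / 2" using small(2)[of "e / 2"] \<open>e > 0\<close> by simp
      also have "\<dots> < e" using \<open>e > 0\<close> by simp
      finally show "dist (G z) (G x) < e" by (simp add: dist_norm)
    qed
  qed
  ultimately show ?thesis by (simp add: C1_on_def G_def[abs_def])
qed

section \<open>A smooth mollifier\<close>

text \<open>The functions of \<open>y\<close> generated by linear functions and by flat functions of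
  \<open>\<epsilon>\<^sup>2 - |y - x|\<^sup>2\<close>. This algebra is closed under directional derivatives and contains the
  mollifier centred at \<open>x\<close> and its first derivatives, which are thereby smooth.\<close>

inductive radial_algebra :: "real \<Rightarrow> 'a::euclidean_space \<Rightarrow> ('a \<Rightarrow> real) \<Rightarrow> bool"
  for \<epsilon> :: real and x :: 'a where
  const: "radial_algebra \<epsilon> x (\<lambda>y. c)"
| inner: "radial_algebra \<epsilon> x (\<lambda>y. a \<bullet> y)"
| flat: "radial_algebra \<epsilon> x (\<lambda>y. flat_exp m (\<epsilon>\<^sup>2 - (norm (y - x))\<^sup>2))"
| add: "radial_algebra \<epsilon> x f \<Longrightarrow> radial_algebra \<epsilon> x f' \<Longrightarrow> radial_algebra \<epsilon> x (\<lambda>y. f y + f' y)"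
| mult: "radial_algebra \<epsilon> x f \<Longrightarrow> radial_algebra \<epsilon> x f' \<Longrightarrow> radial_algebra \<epsilon> x (\<lambda>y. f y * f' y)"

lemma C1_on_flat_exp_norm:
  "C1_on V (\<lambda>y. flat_exp m (\<epsilon>\<^sup>2 - (norm (y - x))\<^sup>2))
     (\<lambda>y. (-2 * (flat_exp (m + 2) (\<epsilon>\<^sup>2 - (norm (y - x))\<^sup>2)
        - real m * flat_exp (m + 1) (\<epsilon>\<^sup>2 - (norm (y - x))\<^sup>2))) *\<^sub>R (y - x))"
proof -
  let ?s = "\<lambda>y. \<epsilon>\<^sup>2 + (-1) * (norm (y - x))\<^sup>2"
  have "C1_on V ?s (\<lambda>y. 0 + ((-1) *\<^sub>R (2 *\<^sub>R (y - x)) + (norm (y - x))\<^sup>2 *\<^sub>R 0))"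
    by (rule C1_on_add C1_on_mult C1_on_const C1_on_norm_squared_diff)+
  from C1_on_compose[OF this DERIV_flat_exp, of m] show ?thesis
    by (simp add: continuous_intros algebra_simps scaleR_left_distrib[symmetric])
qed

lemma radial_algebra_derivative:
  assumes "radial_algebra \<epsilon> x f"
  shows "\<exists>g. C1_on UNIV f g \<and> (\<forall>v. radial_algebra \<epsilon> x (\<lambda>y. g y \<bullet> v))"
  using assms
proof induction
  case (const c)
  show ?case using C1_on_const[of UNIV c] radial_algebra.const[of \<epsilon> x 0] by force
next
  case (inner a)
  show ?case by (intro exI[of _ "\<lambda>y. a"]) (simp add: C1_on_inner radial_algebra.const)
next
  case (flat m)
  let ?E = "\<lambda>m y. flat_exp m (\<epsilon>\<^sup>2 - (norm (y - x))\<^sup>2)"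
  have "radial_algebra \<epsilon> x (\<lambda>y. (-2 * (?E (m + 2) y + (- real m) * ?E (m + 1) y)) * (v \<bullet> y + (- (v \<bullet> x))))" for v
    by (rule radial_algebra.intros)+
  moreover have "(y - x) \<bullet> v = v \<bullet> y + (- (v \<bullet> x))" for y v
    by (simp add: inner_diff_left inner_diff_right inner_commute)
  ultimately have "radial_algebra \<epsilon> x (\<lambda>y. ((-2 * (?E (m + 2) y - real m * ?E (m + 1) y)) *\<^sub>R (y - x)) \<bullet> v)" for v
    by simp
  then show ?case using C1_on_flat_exp_norm[of UNIV m \<epsilon> x] by blast
next
  case (add f f')
  then obtain g g' where "C1_on UNIV f g" "C1_on UNIV f' g'"
    "\<And>v. radial_algebra \<epsilon> x (\<lambda>y. g y \<bullet> v)" "\<And>v. radial_algebra \<epsilon> x (\<lambda>y. g' y \<bullet> v)" by blast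
  then show ?case
    by (intro exI[of _ "\<lambda>y. g y + g' y"]) (simp add: C1_on_add inner_left_distrib radial_algebra.add)
next
  case (mult f f')
  then obtain g g' where "C1_on UNIV f g" "C1_on UNIV f' g'"
    "\<And>v. radial_algebra \<epsilon> x (\<lambda>y. g y \<bullet> v)" "\<And>v. radial_algebra \<epsilon> x (\<lambda>y. g' y \<bullet> v)" by blast
  then show ?case using mult.hyps
    by (intro exI[of _ "\<lambda>y. f y *\<^sub>R g' y + f' y *\<^sub>R g y"])
      (simp add: C1_on_mult inner_left_distrib radial_algebra.add radial_algebra.mult)
qed

text \<open>Induction on the order of differentiability, using closure of the algebra under derivatives.\<close>

lemma radial_algebra_smooth: "radial_algebra \<epsilon> x f \<Longrightarrow> smooth_on UNIV f"
  unfolding smooth_on_def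
proof
  fix k assume "radial_algebra \<epsilon> x f"
  then show "continuously_differentiable_on k UNIV f"
  proof (induction k arbitrary: f)
    case 0
    then show ?case using radial_algebra_derivative C1_on_continuous by fastforce
  next
    case (Suc k)
    then obtain g where g: "C1_on UNIV f g" "\<And>v. radial_algebra \<epsilon> x (\<lambda>y. g y \<bullet> v)"
      using radial_algebra_derivative by blast
    have "frechet_derivative f (at y) = (\<lambda>v. g y \<bullet> v)" for y
      using frechet_derivative_at[OF C1_onD[OF g(1)]] by simp
    moreover have "f differentiable (at y)" for y
      using C1_onD[OF g(1)] unfolding differentiable_def by blast
    ultimately show ?case using Suc.IH[OF g(2)] by simp
  qed
qed

lemma radial_algebra_test_function:
  assumes "radial_algebra \<epsilon> x f" "cball x \<epsilon> \<subseteq> \<Omega>" "\<And>y. y \<notin> cball x \<epsilon> \<Longrightarrow> f y = 0"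
  shows "f \<in> test_functions \<Omega>"
proof -
  have sub: "closure {y. f y \<noteq> 0} \<subseteq> cball x \<epsilon>"
    by (rule closure_minimal) (use assms(3) in blast)+
  then have "compact (closure {y. f y \<noteq> 0})"
    by (meson bounded_cball bounded_subset closed_closure compact_eq_bounded_closed)
  then show ?thesis
    using sub assms(2) radial_algebra_smooth[OF assms(1)] by (auto simp: test_functions_def)
qed

text \<open>The normalising constant; the kernel has support radius \<open>\<epsilon>\<close> without any rescaling of the
  variable.\<close>

definition mollifier_mass :: "real \<Rightarrow> 'a::euclidean_space itself \<Rightarrow> real" where
  "mollifier_mass \<epsilon> _ = (\<integral>z. flat_exp 0 (\<epsilon>\<^sup>2 - (norm (z::'a))\<^sup>2) \<partial>lborel)"

definition mollifier :: "real \<Rightarrow> 'a::euclidean_space \<Rightarrow> real" where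
  "mollifier \<epsilon> z = flat_exp 0 (\<epsilon>\<^sup>2 - (norm z)\<^sup>2) / mollifier_mass \<epsilon> TYPE('a)"

definition mollifier_gradient :: "real \<Rightarrow> 'a::euclidean_space \<Rightarrow> 'a" where
  "mollifier_gradient \<epsilon> z = (-2 * flat_exp 2 (\<epsilon>\<^sup>2 - (norm z)\<^sup>2) / mollifier_mass \<epsilon> TYPE('a)) *\<^sub>R z"

definition mollifier_hessian :: "real \<Rightarrow> 'a::euclidean_space \<Rightarrow> 'a \<Rightarrow> 'a" where
  "mollifier_hessian \<epsilon> a z = (-2 / mollifier_mass \<epsilon> TYPE('a)) *\<^sub>R
     (flat_exp 2 (\<epsilon>\<^sup>2 - (norm z)\<^sup>2) *\<^sub>R a + (a \<bullet> z) *\<^sub>R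
       (-2 * (flat_exp 4 (\<epsilon>\<^sup>2 - (norm z)\<^sup>2) - 2 * flat_exp 3 (\<epsilon>\<^sup>2 - (norm z)\<^sup>2))) *\<^sub>R z)"

text \<open>Symmetry of second derivatives, visible here from the explicit radial formula.\<close>

lemma mollifier_hessian_symmetric:
  "mollifier_hessian \<epsilon> a z \<bullet> b = mollifier_hessian \<epsilon> b z \<bullet> a"
  unfolding mollifier_hessian_def inner_scaleR_left inner_add_left
  by (simp add: inner_commute mult_ac)

lemma mollifier_support:
  fixes z :: "'a::euclidean_space"
  assumes "0 < \<epsilon>" "z \<notin> cball 0 \<epsilon>"
  shows "mollifier \<epsilon> z = 0" "mollifier_gradient \<epsilon> z = 0"
proof -
  have "\<epsilon>\<^sup>2 \<le> (norm z)\<^sup>2" using assms by (intro power_mono) auto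
  then show "mollifier \<epsilon> z = 0" "mollifier_gradient \<epsilon> z = 0"
    by (simp_all add: mollifier_def mollifier_gradient_def flat_exp_eq_0)
qed

lemma C1_mollifier: "C1_on UNIV (mollifier \<epsilon>) (mollifier_gradient \<epsilon> :: 'a::euclidean_space \<Rightarrow> 'a)"
  using C1_on_mult[OF C1_on_const[of UNIV "1 / mollifier_mass \<epsilon> TYPE('a)"] C1_on_flat_exp_norm[of UNIV 0 \<epsilon> 0]]
  by (simp add: mollifier_def[abs_def] mollifier_gradient_def[abs_def] numeral_2_eq_2)

lemma C1_mollifier_gradient:
  "C1_on UNIV (\<lambda>z. mollifier_gradient \<epsilon> z \<bullet> a) (mollifier_hessian \<epsilon> a :: 'a::euclidean_space \<Rightarrow> 'a)"
proof -
  let ?N = "mollifier_mass \<epsilon> TYPE('a)"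
  let ?E = "\<lambda>m (z::'a). flat_exp m (\<epsilon>\<^sup>2 - (norm z)\<^sup>2)"
  have "C1_on UNIV (?E 2) (\<lambda>z. (-2 * (?E 4 z - 2 * ?E 3 z)) *\<^sub>R z)"
    using C1_on_flat_exp_norm[of UNIV 2 \<epsilon> "0::'a"] by simp
  from C1_on_mult[OF C1_on_const[of UNIV "-2 / ?N"] C1_on_mult[OF this C1_on_inner[of UNIV a]]]
  have "C1_on UNIV (\<lambda>z. -2 / ?N * (?E 2 z * (a \<bullet> z))) (mollifier_hessian \<epsilon> a)"
    by (simp only: mollifier_hessian_def[abs_def] scaleR_zero_right add_0_right)
  moreover have "mollifier_gradient \<epsilon> z \<bullet> a = -2 / ?N * (?E 2 z * (a \<bullet> z))" for z
    by (simp add: mollifier_gradient_def inner_commute)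
  ultimately show ?thesis by simp
qed

lemma continuous_mollifier: "continuous_on UNIV (mollifier \<epsilon>)"
  using C1_on_continuous[OF C1_mollifier] .

lemma mollifier_mass_pos:
  assumes "0 < \<epsilon>"
  shows "0 < mollifier_mass \<epsilon> TYPE('a::euclidean_space)"
proof -
  let ?f = "\<lambda>z::'a. flat_exp 0 (\<epsilon>\<^sup>2 - (norm z)\<^sup>2)"
  have int: "integrable lborel ?f"
  proof (rule compact_support_integrable)
    show "compact (cball (0::'a) \<epsilon>)" by simp
    show "?f z = 0" if "z \<notin> cball 0 \<epsilon>" for z
    proof (rule flat_exp_eq_0)
      have "\<epsilon>\<^sup>2 \<le> (norm z)\<^sup>2" using assms that by (intro power_mono) auto
      then show "\<epsilon>\<^sup>2 - (norm z)\<^sup>2 \<le> 0" by simp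
    qed
  qed (intro continuous_intros)
  have "mollifier_mass \<epsilon> TYPE('a) \<noteq> 0"
  proof
    assume "mollifier_mass \<epsilon> TYPE('a) = 0"
    then have "AE z in lborel. ?f z = 0"
      using integral_nonneg_eq_0_iff_AE[OF int] flat_exp_nonneg by (simp add: mollifier_mass_def)
    then have "AE z in lborel. z \<notin> ball (0::'a) \<epsilon>"
    proof eventually_elim
      case (elim z)
      show ?case
      proof
        assume "z \<in> ball 0 \<epsilon>"
        then have "(norm z)\<^sup>2 < \<epsilon>\<^sup>2" by (intro power_strict_mono) auto
        then show False using elim flat_exp_pos[of "\<epsilon>\<^sup>2 - (norm z)\<^sup>2" 0] by simp
      qed
    qed
    then have "emeasure lborel (ball (0::'a) \<epsilon>) = 0"
      by (subst (asm) AE_iff_measurable[of "ball 0 \<epsilon>"]) auto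
    then show False using assms open_not_negligible[of "ball (0::'a) \<epsilon>"]
      by (auto simp: negligible_iff_emeasure0)
  qed
  moreover have "mollifier_mass \<epsilon> TYPE('a) \<ge> 0"
    unfolding mollifier_mass_def by (simp add: flat_exp_nonneg)
  ultimately show ?thesis by linarith
qed

lemma mollifier_nonneg: "0 < \<epsilon> \<Longrightarrow> 0 \<le> mollifier \<epsilon> (z::'a::euclidean_space)"
  using mollifier_mass_pos[where 'a = 'a, of \<epsilon>] by (simp add: mollifier_def flat_exp_nonneg)

lemma integral_mollifier: "0 < \<epsilon> \<Longrightarrow> (\<integral>z. mollifier \<epsilon> (z::'a::euclidean_space) \<partial>lborel) = 1"
  using mollifier_mass_pos[where 'a = 'a, of \<epsilon>] by (simp add: mollifier_def mollifier_mass_def)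

section \<open>Mollified curl-free and divergence-free fields\<close>

text \<open>The distributional equations \<open>curl G = 0\<close> and \<open>div G = 0\<close> in \<open>\<Omega>\<close>, tested against the
  gradient \<open>p\<close> of a test function. The integrals extend over the whole space, so \<open>G\<close> is to be thought
  of as extended from \<open>\<Omega>\<close>; the test functions only see \<open>\<Omega>\<close>.\<close>

definition weakly_curl_div_free :: "(real^3) set \<Rightarrow> (real^3 \<Rightarrow> real^3) \<Rightarrow> bool" where
  "weakly_curl_div_free \<Omega> G \<longleftrightarrow> (\<forall>\<phi> p. \<phi> \<in> test_functions \<Omega> \<longrightarrow> C1_on UNIV \<phi> p \<longrightarrow>
     (\<forall>i j. (\<integral>y. G y $ i * p y $ j \<partial>lborel) = (\<integral>y. G y $ j * p y $ i \<partial>lborel)) \<and>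
     (\<Sum>i\<in>UNIV. \<integral>y. G y $ i * p y $ i \<partial>lborel) = 0)"

lemma C1_on_reflect:
  assumes "C1_on UNIV f g"
  shows "C1_on UNIV (\<lambda>y. f (x - y)) (\<lambda>y. - g (x - y))"
  unfolding C1_on_def
proof (intro conjI ballI)
  show "continuous_on UNIV (\<lambda>y. - g (x - y))"
    by (intro continuous_intros continuous_on_compose2[OF C1_on_continuous_gradient[OF assms]]) auto
  fix y
  have "((\<lambda>y. x - y) has_derivative (\<lambda>v. - v)) (at y)" by (auto intro!: derivative_eq_intros)
  from has_derivative_compose[OF this C1_onD[OF assms UNIV_I]]
  show "((\<lambda>y. f (x - y)) has_derivative (\<lambda>v. - g (x - y) \<bullet> v)) (at y)" by simp
qed

definition mollified :: "real \<Rightarrow> (real^3 \<Rightarrow> real^3) \<Rightarrow> real^3 \<Rightarrow> real^3" where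
  "mollified \<epsilon> G x = (\<chi> i. convolution (mollifier \<epsilon>) (\<lambda>y. G y $ i) x)"

definition mollified_gradient :: "real \<Rightarrow> (real^3 \<Rightarrow> real^3) \<Rightarrow> 3 \<Rightarrow> real^3 \<Rightarrow> real^3" where
  "mollified_gradient \<epsilon> G i x = (\<integral>y. G y $ i *\<^sub>R mollifier_gradient \<epsilon> (x - y) \<partial>lborel)"

definition mollified_hessian :: "real \<Rightarrow> (real^3 \<Rightarrow> real^3) \<Rightarrow> 3 \<Rightarrow> 3 \<Rightarrow> real^3 \<Rightarrow> real^3" where
  "mollified_hessian \<epsilon> G i j x = (\<integral>y. G y $ i *\<^sub>R mollifier_hessian \<epsilon> (axis j 1) (x - y) \<partial>lborel)"

lemma C1_mollified:
  assumes "0 < \<epsilon>" "integrable lborel (\<lambda>y. G y $ i)"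
  shows "C1_on UNIV (\<lambda>x. mollified \<epsilon> G x $ i) (mollified_gradient \<epsilon> G i)"
  using C1_convolution[OF C1_mollifier compact_cball[of 0 \<epsilon>] mollifier_support(1)[OF assms(1)] assms(2)]
  by (simp add: mollified_def mollified_gradient_def[abs_def])

lemma mollified_gradient_component:
  assumes "0 < \<epsilon>" "integrable lborel (\<lambda>y. G y $ i)"
  shows "mollified_gradient \<epsilon> G i x \<bullet> a = (\<integral>y. G y $ i * (mollifier_gradient \<epsilon> (x - y) \<bullet> a) \<partial>lborel)"
  using integrable_reflected_scaleR[OF C1_on_continuous_gradient[OF C1_mollifier] compact_cball[of 0 \<epsilon>]
    mollifier_support(2)[OF assms(1)] assms(2), of x]
  by (simp add: mollified_gradient_def flip: inner_scaleR_left)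

lemma mollifier_gradient_component_support:
  "0 < \<epsilon> \<Longrightarrow> z \<notin> cball 0 \<epsilon> \<Longrightarrow> mollifier_gradient \<epsilon> z \<bullet> a = 0"
  by (simp add: mollifier_support(2))

lemma C1_mollified_gradient:
  assumes "0 < \<epsilon>" "integrable lborel (\<lambda>y. G y $ i)"
  shows "C1_on UNIV (\<lambda>x. mollified_gradient \<epsilon> G i x $ j) (mollified_hessian \<epsilon> G i j)"
proof -
  have "mollified_gradient \<epsilon> G i x $ j =
      convolution (\<lambda>z. mollifier_gradient \<epsilon> z \<bullet> axis j 1) (\<lambda>y. G y $ i) x" for x
    using mollified_gradient_component[OF assms, of x "axis j 1"]
    by (simp add: convolution_def mult.commute inner_axis)
  then show ?thesis
    using C1_convolution[OF C1_mollifier_gradient compact_cball[of 0 \<epsilon>]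
        mollifier_gradient_component_support[OF assms(1)] assms(2), of "axis j 1"]
    by (simp add: mollified_hessian_def[abs_def])
qed

lemma mollified_hessian_component:
  assumes "0 < \<epsilon>" "integrable lborel (\<lambda>y. G y $ i)"
  shows "mollified_hessian \<epsilon> G i j x \<bullet> a =
    (\<integral>y. G y $ i * (mollifier_hessian \<epsilon> (axis j 1) (x - y) \<bullet> a) \<partial>lborel)"
  using integrable_reflected_scaleR[OF C1_on_continuous_gradient[OF C1_mollifier_gradient] compact_cball[of 0 \<epsilon>]
    C1_gradient_support[OF C1_mollifier_gradient closed_cball[of 0 \<epsilon>] mollifier_gradient_component_support[OF assms(1)]]
    assms(2), where x = x]
  by (simp add: mollified_hessian_def flip: inner_scaleR_left)

lemma mollifier_test_function:
  assumes "0 < \<epsilon>" "cball x \<epsilon> \<subseteq> \<Omega>"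
  shows "(\<lambda>y. mollifier \<epsilon> (x - y)) \<in> test_functions \<Omega>"
proof (rule radial_algebra_test_function[OF _ assms(2)])
  have "radial_algebra \<epsilon> x (\<lambda>y. (1 / mollifier_mass \<epsilon> TYPE(real^3)) * flat_exp 0 (\<epsilon>\<^sup>2 - (norm (y - x))\<^sup>2))"
    by (rule radial_algebra.intros)+
  then show "radial_algebra \<epsilon> x (\<lambda>y. mollifier \<epsilon> (x - y))"
    by (simp add: mollifier_def norm_minus_commute)
  show "mollifier \<epsilon> (x - y) = 0" if "y \<notin> cball x \<epsilon>" for y
    using that assms by (intro mollifier_support) (auto simp: dist_norm norm_minus_commute)
qed

lemma mollifier_gradient_test_function:
  assumes "0 < \<epsilon>" "cball x \<epsilon> \<subseteq> \<Omega>"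
  shows "(\<lambda>y. mollifier_gradient \<epsilon> (x - y) \<bullet> a) \<in> test_functions \<Omega>"
proof (rule radial_algebra_test_function[OF _ assms(2)])
  have "radial_algebra \<epsilon> x (\<lambda>y. (-2 / mollifier_mass \<epsilon> TYPE(real^3)) *
      (flat_exp 2 (\<epsilon>\<^sup>2 - (norm (y - x))\<^sup>2) * (a \<bullet> x + (- a) \<bullet> y)))"
    by (rule radial_algebra.intros)+
  moreover have "mollifier_gradient \<epsilon> (x - y) \<bullet> a = (-2 / mollifier_mass \<epsilon> TYPE(real^3)) *
      (flat_exp 2 (\<epsilon>\<^sup>2 - (norm (y - x))\<^sup>2) * (a \<bullet> x + (- a) \<bullet> y))" for y
    by (simp add: mollifier_gradient_def norm_minus_commute inner_commute inner_diff_right)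
  ultimately show "radial_algebra \<epsilon> x (\<lambda>y. mollifier_gradient \<epsilon> (x - y) \<bullet> a)" by simp
  show "mollifier_gradient \<epsilon> (x - y) \<bullet> a = 0" if "y \<notin> cball x \<epsilon>" for y
    using that assms by (intro mollifier_gradient_component_support) (auto simp: dist_norm norm_minus_commute)
qed

text \<open>The kernel centred at \<open>x\<close> is itself a test function as soon as its support lies in \<open>\<Omega>\<close>, so
  the weak equations become pointwise ones for the mollified field.\<close>

lemma mollified_curl_div_free:
  assumes "0 < \<epsilon>" "\<And>i. integrable lborel (\<lambda>y. G y $ i)" "weakly_curl_div_free \<Omega> G" "cball x \<epsilon> \<subseteq> \<Omega>"
  shows "mollified_gradient \<epsilon> G i x $ j = mollified_gradient \<epsilon> G j x $ i"
    "(\<Sum>i\<in>UNIV. mollified_gradient \<epsilon> G i x $ i) = 0"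
proof -
  have c: "mollified_gradient \<epsilon> G i x $ j = (\<integral>y. G y $ i * mollifier_gradient \<epsilon> (x - y) $ j \<partial>lborel)" for i j
    using mollified_gradient_component[OF assms(1,2), of i x "axis j 1"] by (simp add: inner_axis)
  have w: "(\<integral>y. G y $ i * (- mollifier_gradient \<epsilon> (x - y)) $ j \<partial>lborel) =
      (\<integral>y. G y $ j * (- mollifier_gradient \<epsilon> (x - y)) $ i \<partial>lborel)"
    "(\<Sum>i\<in>UNIV. \<integral>y. G y $ i * (- mollifier_gradient \<epsilon> (x - y)) $ i \<partial>lborel) = 0" for i j
    using assms(3) mollifier_test_function[OF assms(1,4)] C1_on_reflect[OF C1_mollifier]
    unfolding weakly_curl_div_free_def by blast+
  show "mollified_gradient \<epsilon> G i x $ j = mollified_gradient \<epsilon> G j x $ i"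
    using w(1)[of i j] by (simp add: c)
  show "(\<Sum>i\<in>UNIV. mollified_gradient \<epsilon> G i x $ i) = 0"
    using w(2) by (simp add: c sum_negf)
qed

text \<open>This is \<open>\<Delta> = grad div - curl curl\<close>: testing with first derivatives of the kernel, the curl
  equation moves the index of the field onto the derivative, symmetry of the Hessian swaps the two
  derivatives, and the divergence equation finishes.\<close>

lemma mollified_harmonic:
  assumes "0 < \<epsilon>" "\<And>i. integrable lborel (\<lambda>y. G y $ i)" "weakly_curl_div_free \<Omega> G" "cball x \<epsilon> \<subseteq> \<Omega>"
  shows "(\<Sum>j\<in>UNIV. mollified_hessian \<epsilon> G i j x $ j) = 0"
proof -
  let ?H = "\<lambda>j k y. mollifier_hessian \<epsilon> (axis j 1) (x - y) $ k :: real"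
  have c: "mollified_hessian \<epsilon> G i j x $ k = (\<integral>y. G y $ i * ?H j k y \<partial>lborel)" for i j k
    using mollified_hessian_component[OF assms(1,2), of i j x "axis k 1"] by (simp add: inner_axis)
  have w: "(\<integral>y. G y $ i * (- mollifier_hessian \<epsilon> (axis l 1) (x - y)) $ j \<partial>lborel) =
      (\<integral>y. G y $ j * (- mollifier_hessian \<epsilon> (axis l 1) (x - y)) $ i \<partial>lborel)"
    "(\<Sum>i\<in>UNIV. \<integral>y. G y $ i * (- mollifier_hessian \<epsilon> (axis l 1) (x - y)) $ i \<partial>lborel) = 0" for i j l
    using assms(3) mollifier_gradient_test_function[OF assms(1,4), of "axis l 1"]
      C1_on_reflect[OF C1_mollifier_gradient[of \<epsilon> "axis l 1"]]
    unfolding weakly_curl_div_free_def by blast+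
  have s: "?H j k y = ?H k j y" for j k y
    using mollifier_hessian_symmetric[of \<epsilon> "axis j 1" "x - y" "axis k 1"] by (simp add: inner_axis)
  have "(\<Sum>j\<in>UNIV. mollified_hessian \<epsilon> G i j x $ j) = (\<Sum>j\<in>UNIV. \<integral>y. G y $ j * ?H j i y \<partial>lborel)"
    unfolding c using w(1)[of i] by (intro sum.cong) auto
  also have "\<dots> = (\<Sum>j\<in>UNIV. \<integral>y. G y $ j * ?H i j y \<partial>lborel)"
    by (simp only: s[where k = i])
  also have "\<dots> = 0" using w(2)[of i] by (simp add: sum_negf)
  finally show ?thesis .
qed

lemma convolution_mollifier_approximates:
  assumes \<epsilon>: "0 < \<epsilon>" and w: "integrable lborel w"
    and close: "\<And>y. y \<in> cball x \<epsilon> \<Longrightarrow> \<bar>w y - w x\<bar> \<le> \<eta>"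
  shows "\<bar>convolution (mollifier \<epsilon>) w x - w x\<bar> \<le> \<eta>"
proof -
  let ?m = "\<lambda>y. mollifier \<epsilon> (x - y)"
  have even: "?m y = mollifier \<epsilon> (y + (- x))" for y
    by (simp add: mollifier_def norm_minus_commute)
  have m1: "(\<integral>y. ?m y \<partial>lborel) = 1"
    unfolding even
    using lborel_integral_translate[OF borel_measurable_continuous_onI[OF continuous_mollifier]]
      integral_mollifier[OF \<epsilon>] by metis
  have mi: "integrable lborel ?m"
    using m1 not_integrable_integral_eq by fastforce
  have ci: "integrable lborel (\<lambda>y. ?m y * w y)"
    using integrable_reflected_scaleR[OF continuous_mollifier compact_cball[of 0 \<epsilon>] mollifier_support(1)[OF \<epsilon>] w, of x]
    by (simp add: mult.commute)
  have "convolution (mollifier \<epsilon>) w x - w x = (\<integral>y. ?m y * w y - ?m y * w x \<partial>lborel)"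
    using ci mi m1 by (simp add: convolution_def)
  also have "\<bar>\<dots>\<bar> \<le> (\<integral>y. ?m y * \<eta> \<partial>lborel)"
  proof (rule Bochner_Integration.integral_abs_bound_integral)
    fix y
    have "\<bar>?m y * (w y - w x)\<bar> \<le> ?m y * \<eta>"
    proof (cases "y \<in> cball x \<epsilon>")
      case True
      then show ?thesis
        using close[OF True] mollifier_nonneg[OF \<epsilon>, of "x - y"] by (simp add: abs_mult mult_left_mono)
    next
      case False
      then have "?m y = 0" using \<epsilon> by (intro mollifier_support) (auto simp: dist_norm norm_minus_commute)
      then show ?thesis by simp
    qed
    then show "\<bar>?m y * w y - ?m y * w x\<bar> \<le> ?m y * \<eta>" by (simp add: right_diff_distrib)
  qed (use ci mi in auto)
  also have "\<dots> = \<eta>" using m1 by simp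
  finally show ?thesis .
qed

definition zero_extension :: "'a set \<Rightarrow> ('a \<Rightarrow> 'b::real_vector) \<Rightarrow> 'a \<Rightarrow> 'b" where
  "zero_extension \<Omega> \<Gamma> x = indicator \<Omega> x *\<^sub>R \<Gamma> x"

lemma continuous_closure_set_integrable:
  fixes f :: "'a::euclidean_space \<Rightarrow> 'b::{banach, second_countable_topology}"
  assumes "bounded \<Omega>" "open \<Omega>" "continuous_on (closure \<Omega>) f"
  shows "set_integrable lborel \<Omega> f"
proof (rule set_integrable_subset)
  show "set_integrable lborel (closure \<Omega>) f"
    unfolding set_integrable_def
    by (rule borel_integrable_compact) (use assms in \<open>auto simp: compact_closure\<close>)
qed (use assms closure_subset in auto)

lemma zero_extension_integrable:
  fixes \<Gamma> :: "real^3 \<Rightarrow> real^3"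
  assumes "bounded \<Omega>" "open \<Omega>" "continuous_on (closure \<Omega>) \<Gamma>"
  shows "integrable lborel (\<lambda>y. zero_extension \<Omega> \<Gamma> y $ i)"
  using continuous_closure_set_integrable[OF assms(1,2) continuous_on_component[OF assms(3)], of i]
  by (simp add: zero_extension_def set_integrable_def)

lemma mollified_uniformly_close:
  assumes "0 < \<epsilon>" "\<And>i. integrable lborel (\<lambda>y. G y $ i)"
    and close: "\<And>y. y \<in> cball x \<epsilon> \<Longrightarrow> dist (G y) (G x) \<le> \<eta>"
  shows "norm (mollified \<epsilon> G x - G x) \<le> 3 * \<eta>"
proof -
  have "\<bar>(mollified \<epsilon> G x - G x) $ i\<bar> \<le> \<eta>" for i
  proof -
    have "\<bar>convolution (mollifier \<epsilon>) (\<lambda>y. G y $ i) x - G x $ i\<bar> \<le> \<eta>"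
    proof (rule convolution_mollifier_approximates[OF assms(1,2)])
      fix y assume "y \<in> cball x \<epsilon>"
      then show "\<bar>G y $ i - G x $ i\<bar> \<le> \<eta>"
        using close[of y] component_le_norm_cart[of "G y - G x" i] by (simp add: dist_norm)
    qed
    then show ?thesis by (simp add: mollified_def)
  qed
  then have "(\<Sum>i\<in>UNIV. \<bar>(mollified \<epsilon> G x - G x) $ i\<bar>) \<le> (\<Sum>i\<in>(UNIV::3 set). \<eta>)"
    by (intro sum_mono)
  then show ?thesis
    using norm_le_l1_cart[of "mollified \<epsilon> G x - G x"] by simp
qed

lemma zero_extension_eq: "x \<in> \<Omega> \<Longrightarrow> zero_extension \<Omega> \<Gamma> x = \<Gamma> x"
  by (simp add: zero_extension_def)

text \<open>Uniform convergence on compact subsets; \<open>\<epsilon>\<close> has to respect both the distance to the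
  complement of \<open>\<Omega>\<close> and the modulus of continuity.\<close>

lemma mollified_converges:
  fixes \<Gamma> :: "real^3 \<Rightarrow> real^3"
  assumes \<Omega>: "bounded \<Omega>" "open \<Omega>" and cont: "continuous_on (closure \<Omega>) \<Gamma>"
    and S: "compact S" "S \<subseteq> \<Omega>" and "\<eta> > 0"
  obtains \<epsilon> where "\<epsilon> > 0" "\<And>x. x \<in> S \<Longrightarrow> cball x \<epsilon> \<subseteq> \<Omega>"
    "\<And>x. x \<in> S \<Longrightarrow> norm (mollified \<epsilon> (zero_extension \<Omega> \<Gamma>) x - \<Gamma> x) \<le> \<eta>"
proof -
  let ?G = "zero_extension \<Omega> \<Gamma>"
  have "uniformly_continuous_on (closure \<Omega>) \<Gamma>"
    by (rule compact_uniformly_continuous[OF cont]) (simp add: compact_closure \<Omega>)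
  then obtain d where "d > 0" and
    d: "\<And>x y. x \<in> closure \<Omega> \<Longrightarrow> y \<in> closure \<Omega> \<Longrightarrow> dist y x < d \<Longrightarrow> dist (\<Gamma> y) (\<Gamma> x) < \<eta> / 3"
    using \<open>\<eta> > 0\<close> unfolding uniformly_continuous_on_def by (metis divide_pos_pos zero_less_numeral)
  obtain s where "s > 0" and s: "(\<Union>x\<in>S. ball x s) \<subseteq> \<Omega>"
    using compact_subset_open_imp_ball_epsilon_subset[OF S(1) \<Omega>(2) S(2)] by blast
  define \<epsilon> where "\<epsilon> = min s d / 2"
  have \<epsilon>: "\<epsilon> > 0" "\<epsilon> < s" "\<epsilon> < d" using \<open>s > 0\<close> \<open>d > 0\<close> by (auto simp: \<epsilon>_def)
  have sub: "cball x \<epsilon> \<subseteq> \<Omega>" if "x \<in> S" for x using s that \<epsilon>(2) by fastforce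
  show thesis
  proof (rule that[OF \<epsilon>(1) sub])
    fix x assume x: "x \<in> S"
    have "norm (mollified \<epsilon> ?G x - ?G x) \<le> 3 * (\<eta> / 3)"
    proof (rule mollified_uniformly_close[OF \<epsilon>(1) zero_extension_integrable[OF \<Omega> cont]])
      fix y assume y: "y \<in> cball x \<epsilon>"
      then have "y \<in> \<Omega>" "x \<in> \<Omega>" using sub[OF x] x S(2) by blast+
      moreover have "dist y x < d" using y \<epsilon> by (auto simp: dist_commute)
      ultimately have "dist (\<Gamma> y) (\<Gamma> x) < \<eta> / 3"
        using closure_subset[of \<Omega>] by (intro d) auto
      then show "dist (?G y) (?G x) \<le> \<eta> / 3"
        using \<open>y \<in> \<Omega>\<close> \<open>x \<in> \<Omega>\<close> by (simp add: zero_extension_eq)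
    qed
    then show "norm (mollified \<epsilon> ?G x - \<Gamma> x) \<le> \<eta>" using x S(2) by (simp add: zero_extension_eq subset_eq)
  qed
qed

section \<open>The maximum principle\<close>

lemma C1_on_DERIV_line:
  assumes "C1_on UNIV f g"
  shows "((\<lambda>t. f (x + t *\<^sub>R a)) has_real_derivative (g (x + t *\<^sub>R a) \<bullet> a)) (at t)"
proof -
  have "((\<lambda>t. x + t *\<^sub>R a) has_derivative (\<lambda>s. s *\<^sub>R a)) (at t)"
    by (auto intro!: derivative_eq_intros)
  from has_derivative_compose[OF this C1_onD[OF assms UNIV_I]]
  show ?thesis by (simp add: has_field_derivative_def mult.commute[of _ "_ \<bullet> _"] fun_eq_iff)
qed

text \<open>Some pure second derivative is positive, and along that axis the function increases strictly
  from its critical point.\<close>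

lemma no_local_max_if_Laplacian_pos:
  fixes u :: "real^'n \<Rightarrow> real"
  assumes u: "C1_on UNIV u g" and g: "\<And>j. C1_on UNIV (\<lambda>x. g x $ j) (h j)"
    and pos: "(\<Sum>j\<in>UNIV. h j x $ j) > 0" and "d > 0" and max: "\<And>y. y \<in> ball x d \<Longrightarrow> u y \<le> u x"
  shows False
proof -
  obtain j where j: "h j x $ j > 0"
    using pos sum_nonpos[of UNIV "\<lambda>j. h j x $ j"] by (meson linorder_not_le)
  define a :: "real^'n" where "a = axis j 1"
  define q where "q t = u (x + t *\<^sub>R a)" for t
  define q' where "q' t = g (x + t *\<^sub>R a) $ j" for t
  have q: "(q has_real_derivative q' t) (at t)" for t
    using C1_on_DERIV_line[OF u, of x a t] by (simp add: q_def[abs_def] q'_def a_def inner_axis)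
  have q': "(q' has_real_derivative h j x $ j) (at 0)"
    using C1_on_DERIV_line[OF g[of j], of x a 0] by (simp add: q'_def[abs_def] a_def inner_axis)
  have loc: "q t \<le> q 0" if "\<bar>t\<bar> < d" for t
    using max[of "x + t *\<^sub>R a"] that by (simp add: q_def a_def dist_norm norm_axis_1)
  have "q' 0 = 0"
    by (rule DERIV_local_max[OF q \<open>d > 0\<close>]) (use loc in auto)
  obtain e where "e > 0" and e: "\<And>t. 0 < t \<Longrightarrow> t < e \<Longrightarrow> q' 0 < q' t"
    using DERIV_pos_inc_right[OF q' j] by auto
  define t where "t = min d e / 2"
  have t: "0 < t" "t < d" "t < e" using \<open>d > 0\<close> \<open>e > 0\<close> by (auto simp: t_def)
  have "q 0 < q t"
  proof (rule DERIV_pos_imp_increasing_open[OF t(1)])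
    show "\<exists>y. (q has_real_derivative y) (at s) \<and> 0 < y" if "0 < s" "s < t" for s
      using q[of s] e[of s] that t \<open>q' 0 = 0\<close> by auto
    show "continuous_on {0..t} q"
      using q by (meson DERIV_continuous continuous_at_imp_continuous_on)
  qed
  then show False using loc[of t] t by simp
qed

text \<open>Adding a small multiple of \<open>|x - p|\<^sup>2\<close> makes the Laplacian positive and so pushes the maximum
  out of the interior; the cost is the error \<open>\<eta>\<close>.\<close>

lemma weak_maximum_principle:
  fixes u :: "real^'n \<Rightarrow> real"
  assumes u: "C1_on UNIV u g" and g: "\<And>j. C1_on UNIV (\<lambda>x. g x $ j) (h j)"
    and harm: "\<And>x. x \<in> K \<Longrightarrow> (\<Sum>j\<in>UNIV. h j x $ j) = 0"
    and K: "compact K" "p \<in> K" and "\<eta> > 0"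
  obtains y where "y \<in> K" "y \<notin> interior K" "u p \<le> u y + \<eta>"
proof -
  obtain R where R: "R > 0" "\<And>x. x \<in> K \<Longrightarrow> norm (x - p) \<le> R"
  proof -
    obtain e where "\<And>x. x \<in> K \<Longrightarrow> dist p x \<le> e"
      using bounded_any_center[of K p] compact_imp_bounded[OF K(1)] by blast
    then have "norm (x - p) \<le> max e 1" if "x \<in> K" for x
      using that by (metis dist_norm norm_minus_commute max.coboundedI1)
    then show thesis using that[of "max e 1"] by simp
  qed
  \<comment> \<open>so that the perturbation \<open>\<delta> |x - p|\<^sup>2\<close> is at most \<open>\<eta>\<close> on \<open>K\<close>\<close>
  define \<delta> where "\<delta> = \<eta> / R\<^sup>2"
  have \<delta>: "\<delta> > 0" using R \<open>\<eta> > 0\<close> by (simp add: \<delta>_def)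
  define v where "v x = u x + \<delta> * (norm (x - p))\<^sup>2" for x
  have v: "C1_on UNIV v (\<lambda>x. g x + (\<delta> *\<^sub>R (2 *\<^sub>R (x - p)) + (norm (x - p))\<^sup>2 *\<^sub>R 0))"
    unfolding v_def[abs_def] by (rule C1_on_add C1_on_mult C1_on_const C1_on_norm_squared_diff u)+
  have v': "C1_on UNIV (\<lambda>x. (g x + (\<delta> *\<^sub>R (2 *\<^sub>R (x - p)) + (norm (x - p))\<^sup>2 *\<^sub>R 0)) $ j)
      (\<lambda>x. h j x + axis j (2 * \<delta>))" for j
  proof -
    have "C1_on UNIV (\<lambda>x. g x $ j + (axis j (2 * \<delta>) \<bullet> x + (- 2 * \<delta> * p $ j)))
       (\<lambda>x. h j x + (axis j (2 * \<delta>) + 0))"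
      by (rule C1_on_add C1_on_const C1_on_inner g)+
    then show ?thesis by (simp add: inner_axis' algebra_simps)
  qed
  have "continuous_on K v"
    using C1_on_continuous[OF v] continuous_on_subset by blast
  then obtain y where y: "y \<in> K" "\<And>x. x \<in> K \<Longrightarrow> v x \<le> v y"
    using continuous_attains_sup[OF K(1)] K(2) by blast
  have "y \<notin> interior K"
  proof
    assume "y \<in> interior K"
    then obtain d where "d > 0" "ball y d \<subseteq> K" by (auto simp: mem_interior)
    moreover have "(\<Sum>j\<in>UNIV. (h j y + axis j (2 * \<delta>)) $ j) > 0"
      using \<delta> harm[OF y(1)] by (simp add: sum.distrib)
    ultimately show False
      using no_local_max_if_Laplacian_pos[OF v v', of y d] y(2) by blast
  qed
  moreover have "u p \<le> u y + \<eta>"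
  proof -
    have "(norm (y - p))\<^sup>2 \<le> R\<^sup>2" using R y(1) by (intro power_mono) auto
    then have "\<delta> * (norm (y - p))\<^sup>2 \<le> \<eta>"
      using R(1) \<open>\<eta> > 0\<close> by (simp add: \<delta>_def divide_le_eq mult_left_mono)
    then show ?thesis using y(2)[OF K(2)] by (simp add: v_def)
  qed
  ultimately show thesis using that y(1) by blast
qed

text \<open>The points at distance at least \<open>r\<close> from the complement: an inner approximation of \<open>\<Omega>\<close> on
  which mollification is legitimate.\<close>

lemma compact_eroded:
  fixes \<Omega> :: "'a::euclidean_space set"
  assumes "bounded \<Omega>" "r > 0"
  shows "compact {x. ball x r \<subseteq> \<Omega>}"
proof -
  have *: "{x. ball x r \<subseteq> \<Omega>} = - (\<Union>z\<in>- \<Omega>. ball z r)"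
    by (auto simp: subset_eq dist_commute)
  have "closed {x. ball x r \<subseteq> \<Omega>}" unfolding * by auto
  moreover have "{x. ball x r \<subseteq> \<Omega>} \<subseteq> \<Omega>" using assms(2) by auto
  ultimately show ?thesis using assms(1) bounded_subset compact_eq_bounded_closed by blast
qed

lemma eroded_boundary_near_frontier:
  fixes \<Omega> :: "'a::euclidean_space set"
  assumes "r > 0" "ball y r \<subseteq> \<Omega>" "y \<notin> interior {x. ball x r \<subseteq> \<Omega>}"
  obtains w where "w \<in> frontier \<Omega>" "dist y w < 2 * r"
proof -
  have "\<not> ball y (2 * r) \<subseteq> \<Omega>"
  proof
    assume *: "ball y (2 * r) \<subseteq> \<Omega>"
    have "ball y r \<subseteq> {x. ball x r \<subseteq> \<Omega>}"
    proof clarify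
      fix x z assume "x \<in> ball y r" "z \<in> ball x r"
      then have "dist y z < 2 * r" using dist_triangle[of y z x] by simp
      then show "z \<in> \<Omega>" using * by auto
    qed
    then have "y \<in> interior {x. ball x r \<subseteq> \<Omega>}"
      using assms(1) by (meson centre_in_ball interior_maximal open_ball subsetD)
    then show False using assms(3) by blast
  qed
  then have "ball y (2 * r) - \<Omega> \<noteq> {}" by blast
  moreover have "y \<in> ball y (2 * r) \<inter> \<Omega>" using assms by auto
  ultimately have "ball y (2 * r) \<inter> frontier \<Omega> \<noteq> {}"
    using connected_Int_frontier[of "ball y (2 * r)" \<Omega>] by blast
  then show thesis using that by auto
qed

text \<open>The scalar maximum principle for the component of the mollified field in the direction of
  \<open>\<Gamma> p\<close>, applied on an eroded domain. Its boundary points are close to the frontier of \<open>\<Omega>\<close>, where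
  the bound is known, and \<open>\<Gamma>\<close> is uniformly continuous. Letting the direction
  depend on \<open>p\<close> is what gives the Euclidean norm, rather than a bound for each coordinate.\<close>

lemma harmonic_field_norm_le_boundary:
  fixes \<Gamma> :: "real^3 \<Rightarrow> real^3"
  assumes \<Omega>: "bounded \<Omega>" "open \<Omega>" and cont: "continuous_on (closure \<Omega>) \<Gamma>"
    and weak: "weakly_curl_div_free \<Omega> (zero_extension \<Omega> \<Gamma>)"
    and bd: "\<And>x. x \<in> frontier \<Omega> \<Longrightarrow> norm (\<Gamma> x) \<le> M" and p: "p \<in> \<Omega>"
  shows "norm (\<Gamma> p) \<le> M"
proof (rule field_le_epsilon)
  fix \<eta>' :: real assume "\<eta>' > 0"
  define \<eta> where "\<eta> = \<eta>' / 4"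
  have \<eta>: "\<eta> > 0" using \<open>\<eta>' > 0\<close> by (simp add: \<eta>_def)
  let ?G = "zero_extension \<Omega> \<Gamma>"
  note Gi = zero_extension_integrable[OF \<Omega> cont]
  have "uniformly_continuous_on (closure \<Omega>) \<Gamma>"
    by (rule compact_uniformly_continuous[OF cont]) (simp add: compact_closure \<Omega>)
  then obtain d where "d > 0" and
    d: "\<And>x y. x \<in> closure \<Omega> \<Longrightarrow> y \<in> closure \<Omega> \<Longrightarrow> dist y x < d \<Longrightarrow> dist (\<Gamma> y) (\<Gamma> x) < \<eta>"
    using \<eta> unfolding uniformly_continuous_on_def by metis
  obtain s where "s > 0" "ball p s \<subseteq> \<Omega>" using \<Omega>(2) p open_contains_ball by blast
  define r where "r = min s d / 2"
  have r: "r > 0" "2 * r \<le> d" "r \<le> s" using \<open>s > 0\<close> \<open>d > 0\<close> by (auto simp: r_def)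
  define K where "K = {x. ball x r \<subseteq> \<Omega>}"
  have pK: "p \<in> K" using \<open>ball p s \<subseteq> \<Omega>\<close> r(3) by (auto simp: K_def)
  have inK: "x \<in> \<Omega>" "x \<in> closure \<Omega>" if "x \<in> K" for x
    using that r(1) closure_subset[of \<Omega>] by (auto simp: K_def subset_eq)
  have K: "compact K" unfolding K_def by (rule compact_eroded[OF \<Omega>(1) r(1)])
  obtain \<epsilon> where \<epsilon>: "\<epsilon> > 0" and sub: "\<And>x. x \<in> K \<Longrightarrow> cball x \<epsilon> \<subseteq> \<Omega>"
    and close: "\<And>x. x \<in> K \<Longrightarrow> norm (mollified \<epsilon> ?G x - \<Gamma> x) \<le> \<eta>"
    using mollified_converges[OF \<Omega> cont K _ \<eta>] inK(1) by blast
  \<comment> \<open>if \<open>\<Gamma> p = 0\<close> this is the zero vector, and the estimates below still hold\<close>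
  define e where "e = \<Gamma> p /\<^sub>R norm (\<Gamma> p)"
  have ne: "norm e \<le> 1" by (cases "\<Gamma> p = 0") (auto simp: e_def)
  have ep: "e \<bullet> \<Gamma> p = norm (\<Gamma> p)"
    by (cases "\<Gamma> p = 0") (simp_all add: e_def power2_norm_eq_inner[symmetric] power2_eq_square)
  have ele: "e \<bullet> x \<le> norm x" for x
    using norm_cauchy_schwarz[of e x] mult_right_mono[OF ne, of "norm x"] by simp
  define u where "u x = (\<Sum>i\<in>UNIV. e $ i * mollified \<epsilon> ?G x $ i)" for x
  have ue: "u x = e \<bullet> mollified \<epsilon> ?G x" for x
    by (simp add: u_def inner_vec_def)
  define g where "g x = (\<Sum>i\<in>UNIV. e $ i *\<^sub>R mollified_gradient \<epsilon> ?G i x + mollified \<epsilon> ?G x $ i *\<^sub>R 0)" for x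
  have u: "C1_on UNIV u g"
    unfolding u_def[abs_def] g_def[abs_def]
    by (intro C1_on_sum C1_on_mult C1_on_const C1_mollified \<epsilon> Gi)
  have g: "C1_on UNIV (\<lambda>x. g x $ j) (\<lambda>x. \<Sum>i\<in>UNIV. e $ i *\<^sub>R mollified_hessian \<epsilon> ?G i j x
      + mollified_gradient \<epsilon> ?G i x $ j *\<^sub>R 0)" for j
  proof -
    have "g x $ j = (\<Sum>i\<in>UNIV. e $ i * mollified_gradient \<epsilon> ?G i x $ j)" for x
      by (simp add: g_def)
    then show ?thesis
      by (simp only:) (intro C1_on_sum C1_on_mult C1_on_const C1_mollified_gradient \<epsilon> Gi)
  qed
  have harm: "(\<Sum>j\<in>UNIV. (\<Sum>i\<in>UNIV. e $ i *\<^sub>R mollified_hessian \<epsilon> ?G i j x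
      + mollified_gradient \<epsilon> ?G i x $ j *\<^sub>R 0) $ j) = 0" if "x \<in> K" for x
  proof -
    have "(\<Sum>j\<in>UNIV. (\<Sum>i\<in>UNIV. e $ i *\<^sub>R mollified_hessian \<epsilon> ?G i j x
      + mollified_gradient \<epsilon> ?G i x $ j *\<^sub>R 0) $ j) =
      (\<Sum>j\<in>UNIV. \<Sum>i\<in>UNIV. e $ i * mollified_hessian \<epsilon> ?G i j x $ j)" by simp
    also have "\<dots> = (\<Sum>i\<in>UNIV. e $ i * (\<Sum>j\<in>UNIV. mollified_hessian \<epsilon> ?G i j x $ j))"
      by (subst sum.swap) (simp add: sum_distrib_left)
    also have "\<dots> = 0" using mollified_harmonic[OF \<epsilon> Gi weak sub[OF that]] by simp
    finally show ?thesis .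
  qed
  obtain y where y: "y \<in> K" "y \<notin> interior K" "u p \<le> u y + \<eta>"
    using weak_maximum_principle[OF u g harm K pK \<eta>] by blast
  obtain w where w: "w \<in> frontier \<Omega>" "dist y w < 2 * r"
    using eroded_boundary_near_frontier[OF r(1)] y(1,2) unfolding K_def by blast
  have "dist (\<Gamma> y) (\<Gamma> w) < \<eta>"
    using w r inK[OF y(1)] by (intro d) (auto simp: frontier_def)
  then have 1: "norm (\<Gamma> y) \<le> M + \<eta>"
    using bd[OF w(1)] norm_triangle_ineq2[of "\<Gamma> y" "\<Gamma> w"] by (simp add: dist_norm)
  have 2: "u y - e \<bullet> \<Gamma> y \<le> \<eta>"
    using ele[of "mollified \<epsilon> ?G y - \<Gamma> y"] close[OF y(1)] by (simp add: ue inner_diff_right)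
  have 3: "e \<bullet> \<Gamma> p - u p \<le> \<eta>"
    using ele[of "\<Gamma> p - mollified \<epsilon> ?G p"] close[OF pK] by (simp add: ue inner_diff_right norm_minus_commute)
  show "norm (\<Gamma> p) \<le> M + \<eta>'"
    using 1 2 3 y(3) ele[of "\<Gamma> y"] by (simp add: ep \<eta>_def)
qed

section \<open>Weak divergence theorem up to the boundary\<close>

lemma smooth_on_C1:
  assumes "smooth_on U \<rho>"
  shows "C1_on U \<rho> (grad \<rho>)"
proof -
  have "continuously_differentiable_on (Suc 0) U \<rho>" using assms unfolding smooth_on_def by blast
  then have diff: "\<And>x. x \<in> U \<Longrightarrow> \<rho> differentiable (at x)"
    and cont: "\<And>v. continuous_on U (\<lambda>x. frechet_derivative \<rho> (at x) v)" by auto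
  have eq: "frechet_derivative \<rho> (at x) = (\<lambda>v. grad \<rho> x \<bullet> v)" if "x \<in> U" for x
  proof
    fix v
    have lin: "linear (frechet_derivative \<rho> (at x))"
      by (rule linear_frechet_derivative[OF diff[OF that]])
    have "frechet_derivative \<rho> (at x) v = frechet_derivative \<rho> (at x) (\<Sum>j\<in>UNIV. v $ j *\<^sub>R axis j 1)"
      using basis_expansion[of v] by (simp add: scalar_mult_eq_scaleR)
    also have "\<dots> = (\<Sum>j\<in>UNIV. v $ j * frechet_derivative \<rho> (at x) (axis j 1))"
      by (simp add: linear_sum[OF lin] linear_scale[OF lin])
    also have "\<dots> = grad \<rho> x \<bullet> v"
      by (simp add: grad_def partial_deriv_def inner_vec_def mult.commute)
    finally show "frechet_derivative \<rho> (at x) v = grad \<rho> x \<bullet> v" .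
  qed
  show ?thesis
    unfolding C1_on_def
  proof (intro conjI ballI)
    show "continuous_on U (grad \<rho>)"
      unfolding grad_def[abs_def] partial_deriv_def by (intro continuous_on_vec_lambda cont)
    show "(\<rho> has_derivative (\<lambda>v. grad \<rho> x \<bullet> v)) (at x)" if "x \<in> U" for x
      using diff[OF that] frechet_derivative_works[of \<rho> "at x"] eq[OF that] by simp
  qed
qed

text \<open>Compactness turns vanishing on the zero level into uniform smallness in a thin layer.\<close>

lemma small_near_zero_level:
  fixes f \<rho> :: "'a::topological_space \<Rightarrow> real"
  assumes "compact K" "continuous_on K f" "continuous_on K \<rho>"
    and zero: "\<And>x. x \<in> K \<Longrightarrow> 0 \<le> \<rho> x \<Longrightarrow> f x = 0" and "\<eta> > 0"
  obtains d where "d > 0" "\<And>x. x \<in> K \<Longrightarrow> - d < \<rho> x \<Longrightarrow> \<bar>f x\<bar> < \<eta>"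
proof -
  define K' where "K' = {x \<in> K. \<eta> \<le> \<bar>f x\<bar>}"
  have "compact K'"
  proof -
    have "closedin (top_of_set K) (K \<inter> (\<lambda>x. \<bar>f x\<bar>) -` {\<eta>..})"
      by (rule continuous_closedin_preimage) (use assms in \<open>auto intro!: continuous_intros\<close>)
    moreover have "K' = K \<inter> (\<lambda>x. \<bar>f x\<bar>) -` {\<eta>..}" by (auto simp: K'_def)
    ultimately show ?thesis using assms(1) closedin_compact by metis
  qed
  show thesis
  proof (cases "K' = {}")
    case True
    then show thesis using that[of 1] by (force simp: K'_def)
  next
    case False
    have "continuous_on K' \<rho>" using assms(3) by (rule continuous_on_subset) (auto simp: K'_def)
    then obtain z where z: "z \<in> K'" "\<And>x. x \<in> K' \<Longrightarrow> \<rho> x \<le> \<rho> z"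
      using continuous_attains_sup[OF \<open>compact K'\<close> False] by blast
    have "\<rho> z < 0" using z(1) zero[of z] \<open>\<eta> > 0\<close> by (fastforce simp: K'_def)
    moreover have "\<bar>f x\<bar> < \<eta>" if "x \<in> K" "\<rho> z < \<rho> x" for x
      using z(2)[of x] that by (fastforce simp: K'_def)
    ultimately show thesis using that[of "- \<rho> z"] by simp
  qed
qed

lemma set_integrable_continuous_on_support:
  fixes f :: "'a::euclidean_space \<Rightarrow> real"
  assumes "bounded \<Omega>" "open \<Omega>" "closed S" "continuous_on (closure \<Omega> \<inter> S) f" "\<And>x. x \<notin> S \<Longrightarrow> f x = 0"
  shows "set_integrable lborel \<Omega> f"
proof -
  have "compact (closure \<Omega> \<inter> S)" using assms by (auto simp: compact_closure intro: compact_Int_closed)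
  then have "set_integrable lborel (closure \<Omega> \<inter> S) f"
    unfolding set_integrable_def by (rule borel_integrable_compact) (rule assms)
  moreover have "\<Omega> \<inter> S \<in> sets lborel" using assms by auto
  ultimately have "set_integrable lborel (\<Omega> \<inter> S) f"
    by (rule set_integrable_subset) (use closure_subset[of \<Omega>] in auto)
  moreover have "(\<lambda>x. indicator (\<Omega> \<inter> S) x *\<^sub>R f x) = (\<lambda>x. indicator \<Omega> x *\<^sub>R f x)"
    using assms(5) by (auto simp: indicator_def fun_eq_iff)
  ultimately show ?thesis by (simp only: set_integrable_def)
qed

text \<open>Vanishing divergence in the sense of distributions, tested with compactly supported functions of
  class \<open>C\<^sup>1\<close>.\<close>

definition divergence_free_on :: "'a::euclidean_space set \<Rightarrow> ('a \<Rightarrow> 'a) \<Rightarrow> bool" where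
  "divergence_free_on \<Omega> X \<longleftrightarrow> (\<forall>\<psi> g S. C1_on UNIV \<psi> g \<longrightarrow> compact S \<longrightarrow> S \<subseteq> \<Omega> \<longrightarrow>
     (\<forall>x. x \<notin> S \<longrightarrow> \<psi> x = 0) \<longrightarrow> (LINT x:\<Omega>|lborel. X x \<bullet> g x) = 0)"

text \<open>With \<open>a = n\<close> this is the cut-off that is 1 where \<open>\<rho> \<le> -2/n\<close> and 0 where \<open>\<rho> \<ge> -1/n\<close>.\<close>

lemma C1_on_boundary_cutoff:
  assumes "C1_on V \<rho> k"
  shows "C1_on V (\<lambda>x. smooth_step (- a * \<rho> x - 1)) (\<lambda>x. - (a * smooth_step' (- a * \<rho> x - 1)) *\<^sub>R k x)"
proof -
  have "C1_on V (\<lambda>x. (- a) * \<rho> x + (- 1)) (\<lambda>x. ((- a) *\<^sub>R k x + \<rho> x *\<^sub>R 0) + 0)"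
    by (rule C1_on_add C1_on_mult C1_on_const assms)+
  from C1_on_compose[OF this DERIV_smooth_step continuous_smooth_step'] show ?thesis
    by (simp add: mult.commute)
qed

text \<open>The derivative of the cut-off has size \<open>a\<close> on a layer of thickness \<open>1/a\<close>, so its integral is
  bounded uniformly in \<open>a\<close>. Instead of measuring the layer, integrate by parts in a direction \<open>e\<close>
  transversal to it: the integrand is dominated by the derivative of the cut-off along \<open>e\<close>, and moving
  that derivative onto \<open>\<zeta>\<close> removes \<open>a\<close>.\<close>

lemma layer_integral_bounded:
  fixes \<rho> :: "'a::euclidean_space \<Rightarrow> real"
  assumes \<rho>: "C1_on U \<rho> k" and U: "open U" "cball p s \<subseteq> U"
    and \<zeta>: "C1_on UNIV \<zeta> g" "\<And>x. 0 \<le> \<zeta> x" "\<And>x. x \<notin> cball p s \<Longrightarrow> \<zeta> x = 0"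
    and m: "m > 0" "\<And>x. x \<in> cball p s \<Longrightarrow> m \<le> k x \<bullet> e" and a: "a > 0"
  shows "integrable lborel (\<lambda>x. \<zeta> x * (a * smooth_step' (- a * \<rho> x - 1)))"
    "(\<integral>x. \<zeta> x * (a * smooth_step' (- a * \<rho> x - 1)) \<partial>lborel) \<le> (\<integral>x. \<bar>g x \<bullet> e\<bar> \<partial>lborel) / m"
proof -
  define \<theta> where "\<theta> x = smooth_step (- a * \<rho> x - 1)" for x
  define \<sigma> where "\<sigma> x = a * smooth_step' (- a * \<rho> x - 1)" for x
  have \<sigma>0: "0 \<le> \<sigma> x" for x using a smooth_step'_nonneg by (simp add: \<sigma>_def)
  have \<theta>: "C1_on U \<theta> (\<lambda>x. - \<sigma> x *\<^sub>R k x)"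
    using C1_on_boundary_cutoff[OF \<rho>, of a] by (simp add: \<theta>_def[abs_def] \<sigma>_def)
  have g0: "g x = 0" if "x \<notin> cball p s" for x
    using C1_gradient_support[OF \<zeta>(1) closed_cball \<zeta>(3) that] .
  have P: "C1_on UNIV (\<lambda>x. \<zeta> x * \<theta> x) (\<lambda>x. \<zeta> x *\<^sub>R (- \<sigma> x *\<^sub>R k x) + \<theta> x *\<^sub>R g x)"
    by (rule C1_on_mult_local[OF \<zeta>(1) closed_cball U(2,1) \<zeta>(3) \<theta>])
  have c\<rho>: "continuous_on (cball p s) \<rho>" and ck: "continuous_on (cball p s) k"
    and c\<theta>: "continuous_on (cball p s) \<theta>" and c\<zeta>: "continuous_on (cball p s) \<zeta>"
    and cg: "continuous_on (cball p s) g"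
    using C1_on_continuous[OF \<rho>] C1_on_continuous_gradient[OF \<rho>] C1_on_continuous[OF \<theta>]
      C1_on_continuous[OF \<zeta>(1)] C1_on_continuous_gradient[OF \<zeta>(1)] U(2)
    by (auto intro: continuous_on_subset)
  have c\<sigma>: "continuous_on (cball p s) \<sigma>"
    unfolding \<sigma>_def[abs_def]
    by (intro continuous_intros continuous_on_compose2[OF continuous_smooth_step'] c\<rho>) auto
  have i1: "integrable lborel (\<lambda>x. \<zeta> x * \<sigma> x)"
    by (rule integrable_continuous_on_support[OF compact_cball[of p s]])
      (use \<zeta>(3) in \<open>auto intro!: continuous_intros c\<zeta> c\<sigma>\<close>)
  have i2: "integrable lborel (\<lambda>x. \<zeta> x * \<sigma> x * (k x \<bullet> e))"
    by (rule integrable_continuous_on_support[OF compact_cball[of p s]])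
      (use \<zeta>(3) in \<open>auto intro!: continuous_intros c\<zeta> c\<sigma> ck\<close>)
  have i3: "integrable lborel (\<lambda>x. \<theta> x * (g x \<bullet> e))"
    by (rule integrable_continuous_on_support[OF compact_cball[of p s]])
      (use g0 in \<open>auto intro!: continuous_intros c\<theta> cg\<close>)
  have i4: "integrable lborel (\<lambda>x. \<bar>g x \<bullet> e\<bar>)"
    by (rule integrable_continuous_on_support[OF compact_cball[of p s]])
      (use g0 in \<open>auto intro!: continuous_intros cg\<close>)
  show "integrable lborel (\<lambda>x. \<zeta> x * (a * smooth_step' (- a * \<rho> x - 1)))"
    using i1 by (simp add: \<sigma>_def[abs_def])
  have "m * (\<integral>x. \<zeta> x * \<sigma> x \<partial>lborel) = (\<integral>x. m * (\<zeta> x * \<sigma> x) \<partial>lborel)" by simp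
  also have "\<dots> \<le> (\<integral>x. \<zeta> x * \<sigma> x * (k x \<bullet> e) \<partial>lborel)"
  proof (rule integral_mono)
    fix x
    show "m * (\<zeta> x * \<sigma> x) \<le> \<zeta> x * \<sigma> x * (k x \<bullet> e)"
    proof (cases "x \<in> cball p s")
      case True
      have "m * (\<zeta> x * \<sigma> x) \<le> (k x \<bullet> e) * (\<zeta> x * \<sigma> x)"
        using m(2)[OF True] \<zeta>(2) \<sigma>0 by (intro mult_right_mono) auto
      then show ?thesis by (simp add: mult.commute)
    next
      case False then show ?thesis using \<zeta>(3) by simp
    qed
  qed (use i1 i2 in auto)
  also have "\<dots> = (\<integral>x. \<theta> x * (g x \<bullet> e) \<partial>lborel)"
  proof -
    have "(\<integral>x. (\<zeta> x *\<^sub>R (- \<sigma> x *\<^sub>R k x) + \<theta> x *\<^sub>R g x) \<bullet> e \<partial>lborel) = 0"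
      by (rule integral_gradient_eq_0[OF P compact_cball[of p s]]) (use \<zeta>(3) in simp)
    then have "(\<integral>x. \<theta> x * (g x \<bullet> e) - \<zeta> x * \<sigma> x * (k x \<bullet> e) \<partial>lborel) = 0"
      by (simp add: inner_left_distrib inner_diff_left algebra_simps)
    then show ?thesis using i2 i3 by simp
  qed
  also have "\<dots> \<le> (\<integral>x. \<bar>g x \<bullet> e\<bar> \<partial>lborel)"
  proof (rule integral_mono[OF i3 i4])
    fix x
    have "\<theta> x * (g x \<bullet> e) \<le> \<theta> x * \<bar>g x \<bullet> e\<bar>"
      using smooth_step_bounds by (intro mult_left_mono) (auto simp: \<theta>_def)
    also have "\<dots> \<le> 1 * \<bar>g x \<bullet> e\<bar>" using smooth_step_bounds by (intro mult_right_mono) (auto simp: \<theta>_def)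
    finally show "\<theta> x * (g x \<bullet> e) \<le> \<bar>g x \<bullet> e\<bar>" by simp
  qed
  finally show "(\<integral>x. \<zeta> x * (a * smooth_step' (- a * \<rho> x - 1)) \<partial>lborel) \<le> (\<integral>x. \<bar>g x \<bullet> e\<bar> \<partial>lborel) / m"
    using m(1) by (simp add: \<sigma>_def field_simps)
qed

text \<open>Cutting off \<open>\<psi>\<close> near the boundary makes it admissible. What remains to be shown is that the
  term containing the derivative of the cut-off tends to zero: it is \<open>X \<bullet> grad \<rho>\<close>, small in the layer,
  times a factor with bounded integral.\<close>

lemma divergence_free_up_to_boundary_local:
  fixes X :: "real^3 \<Rightarrow> real^3"
  assumes \<Omega>: "bounded \<Omega>" "open \<Omega>" and X: "continuous_on (closure \<Omega>) X" "divergence_free_on \<Omega> X"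
    and \<rho>: "local_defining_function \<Omega> p U \<rho>"
    and normal: "\<And>x. x \<in> frontier \<Omega> \<inter> U \<Longrightarrow> X x \<bullet> grad \<rho> x = 0"
  obtains r where "r > 0" "\<And>\<psi> g. C1_on UNIV \<psi> g \<Longrightarrow> (\<And>x. x \<notin> cball p r \<Longrightarrow> \<psi> x = 0) \<Longrightarrow>
    (LINT x:\<Omega>|lborel. X x \<bullet> g x) = 0"
proof -
  have U: "open U" "p \<in> U" and below: "\<Omega> \<inter> U = {x \<in> U. \<rho> x < 0}"
    using \<rho> by (auto simp: local_defining_function_def)
  define k where "k = grad \<rho>"
  have C1: "C1_on U \<rho> k"
    using \<rho> smooth_on_C1 unfolding local_defining_function_def k_def by blast
  \<comment> \<open>by continuity the gradient of \<open>\<rho>\<close> stays transversal to the level sets along the fixed vector \<open>e\<close> near \<open>p\<close>\<close>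
  define e where "e = k p"
  define m where "m = (e \<bullet> e) / 2"
  have e: "e \<noteq> 0" using \<rho> by (auto simp: local_defining_function_def e_def k_def)
  then have m: "m > 0" by (simp add: m_def)
  have "continuous_on U (\<lambda>x. k x \<bullet> e)"
    using C1_on_continuous_gradient[OF C1] by (intro continuous_intros)
  then have "open (U \<inter> (\<lambda>x. k x \<bullet> e) -` {m<..})"
    using U(1) by (intro continuous_open_preimage) auto
  moreover have "p \<in> U \<inter> (\<lambda>x. k x \<bullet> e) -` {m<..}"
    using U(2) e by (simp add: m_def e_def)
  ultimately obtain s where "s > 0" and s: "cball p s \<subseteq> U \<inter> (\<lambda>x. k x \<bullet> e) -` {m<..}"
    using open_contains_cball by metis
  then have sU: "cball p s \<subseteq> U" and sm: "\<And>x. x \<in> cball p s \<Longrightarrow> m \<le> k x \<bullet> e" by force+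
  define r where "r = s / 2"
  have r: "r > 0" using \<open>s > 0\<close> by (simp add: r_def)
  obtain \<zeta> g\<zeta> where \<zeta>: "C1_on UNIV \<zeta> g\<zeta>" "\<And>x. 0 \<le> \<zeta> x" "\<And>x. x \<in> cball p r \<Longrightarrow> \<zeta> x = 1"
    "\<And>x. x \<notin> cball p s \<Longrightarrow> \<zeta> x = 0"
    using C1_on_bump[OF r, of p] unfolding r_def by auto
  have rU: "cball p r \<subseteq> U" using sU \<open>s > 0\<close> by (force simp: r_def)
  define C where "C = (\<integral>x. \<bar>g\<zeta> x \<bullet> e\<bar> \<partial>lborel) / m"
  have C0: "C \<ge> 0" using m by (simp add: C_def)
  define K where "K = closure \<Omega> \<inter> cball p r"
  have K: "compact K" "K \<subseteq> closure \<Omega>" "K \<subseteq> U"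
    using rU by (auto simp: K_def compact_closure \<Omega> intro: compact_Int_closed)
  have cX: "continuous_on K X" and c\<rho>: "continuous_on K \<rho>" and ck: "continuous_on K k"
    using X(1) C1_on_continuous[OF C1] C1_on_continuous_gradient[OF C1] K
    by (auto intro: continuous_on_subset)
  show thesis
  proof (rule that[OF r])
    fix \<psi> g assume \<psi>: "C1_on UNIV \<psi> g" and \<psi>0: "\<And>x. x \<notin> cball p r \<Longrightarrow> \<psi> x = 0"
    have g0: "g x = 0" if "x \<notin> cball p r" for x
      using C1_gradient_support[OF \<psi> closed_cball \<psi>0 that] .
    obtain P where P: "\<And>x. \<bar>\<psi> x\<bar> \<le> P"
      using compact_support_bounded[OF C1_on_continuous[OF \<psi>] compact_cball[of p r] \<psi>0] by auto
    have P0: "P \<ge> 0" using P[of p] by linarith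
    have c\<psi>: "continuous_on K \<psi>" and cg: "continuous_on K g"
      using C1_on_continuous[OF \<psi>] C1_on_continuous_gradient[OF \<psi>] by (auto intro: continuous_on_subset)
    \<comment> \<open>\<open>\<theta> n\<close> is the cut-off at depth \<open>1 / Suc n\<close>, and its gradient is \<open>- \<sigma> n x *\<^sub>R k x\<close>\<close>
    define \<theta> where "\<theta> n x = smooth_step (- real (Suc n) * \<rho> x - 1)" for n x
    define \<sigma> where "\<sigma> n x = real (Suc n) * smooth_step' (- real (Suc n) * \<rho> x - 1)" for n x
    have \<sigma>0: "0 \<le> \<sigma> n x" for n x using smooth_step'_nonneg by (simp add: \<sigma>_def)
    have \<theta>b: "0 \<le> \<theta> n x" "\<theta> n x \<le> 1" for n x by (simp_all add: \<theta>_def smooth_step_bounds)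
    have \<theta>: "C1_on U (\<theta> n) (\<lambda>x. - \<sigma> n x *\<^sub>R k x)" for n
      using C1_on_boundary_cutoff[OF C1, of "real (Suc n)"] by (simp only: \<theta>_def[abs_def] \<sigma>_def)
    have c\<theta>: "continuous_on K (\<theta> n)" for n
      using C1_on_continuous[OF \<theta>] K by (auto intro: continuous_on_subset)
    have c\<sigma>: "continuous_on K (\<sigma> n)" for n
      unfolding \<sigma>_def[abs_def]
      by (intro continuous_intros continuous_on_compose2[OF continuous_smooth_step'] c\<rho>) auto
    have i1: "set_integrable lborel \<Omega> (\<lambda>x. \<theta> n x * (X x \<bullet> g x))" for n
      by (rule set_integrable_continuous_on_support[OF \<Omega> closed_cball[of p r]])
        (use g0 in \<open>auto intro!: continuous_intros c\<theta> cX cg simp flip: K_def\<close>)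
    have i2: "set_integrable lborel \<Omega> (\<lambda>x. \<psi> x * \<sigma> n x * (X x \<bullet> k x))" for n
      by (rule set_integrable_continuous_on_support[OF \<Omega> closed_cball[of p r]])
        (use \<psi>0 in \<open>auto intro!: continuous_intros c\<psi> cX c\<sigma> ck simp flip: K_def\<close>)
    have i3: "set_integrable lborel \<Omega> (\<lambda>x. X x \<bullet> g x)"
      by (rule set_integrable_continuous_on_support[OF \<Omega> closed_cball[of p r]])
        (use g0 in \<open>auto intro!: continuous_intros cX cg simp flip: K_def\<close>)
    have layer: "integrable lborel (\<lambda>x. \<zeta> x * \<sigma> n x)" "(\<integral>x. \<zeta> x * \<sigma> n x \<partial>lborel) \<le> C" for n
      using layer_integral_bounded[OF C1 U(1) sU \<zeta>(1,2,4) m sm, of "real (Suc n)"]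
      by (auto simp: \<sigma>_def C_def)
    have id: "(LINT x:\<Omega>|lborel. \<theta> n x * (X x \<bullet> g x)) = (LINT x:\<Omega>|lborel. \<psi> x * \<sigma> n x * (X x \<bullet> k x))" for n
    proof -
      define S where "S = {x \<in> cball p r. \<rho> x \<le> - 1 / real (Suc n)}"
      have "closed S"
      proof -
        have "continuous_on (cball p r) \<rho>"
          using C1_on_continuous[OF C1] rU continuous_on_subset by blast
        then have "closed (cball p r \<inter> \<rho> -` {..- 1 / real (Suc n)})"
          by (intro continuous_closed_preimage) auto
        moreover have "S = cball p r \<inter> \<rho> -` {..- 1 / real (Suc n)}" by (auto simp: S_def)
        ultimately show ?thesis by simp
      qed
      then have "compact S"
        unfolding compact_eq_bounded_closed
        by (intro conjI bounded_subset[OF bounded_cball[of p r], of S]) (auto simp: S_def)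
      moreover have "S \<subseteq> \<Omega>"
      proof
        fix x assume "x \<in> S"
        then have "x \<in> U" "\<rho> x < 0" using rU by (auto simp: S_def intro: le_less_trans)
        then show "x \<in> \<Omega>" using below by blast
      qed
      moreover have "\<psi> x * \<theta> n x = 0" if "x \<notin> S" for x
      proof (cases "x \<in> cball p r")
        case True
        then have "- 1 / real (Suc n) < \<rho> x" using that by (auto simp: S_def)
        then have "- real (Suc n) * \<rho> x - 1 \<le> 0" by (simp add: field_simps)
        then show ?thesis by (simp add: \<theta>_def smooth_step_eq)
      qed (use \<psi>0 in simp)
      moreover have "C1_on UNIV (\<lambda>x. \<psi> x * \<theta> n x) (\<lambda>x. \<psi> x *\<^sub>R (- \<sigma> n x *\<^sub>R k x) + \<theta> n x *\<^sub>R g x)"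
        by (rule C1_on_mult_local[OF \<psi> closed_cball rU U(1) \<psi>0 \<theta>])
      ultimately have "(LINT x:\<Omega>|lborel. X x \<bullet> (\<psi> x *\<^sub>R (- \<sigma> n x *\<^sub>R k x) + \<theta> n x *\<^sub>R g x)) = 0"
        using X(2) unfolding divergence_free_on_def by blast
      moreover have "X x \<bullet> (\<psi> x *\<^sub>R (- \<sigma> n x *\<^sub>R k x) + \<theta> n x *\<^sub>R g x) =
          \<theta> n x * (X x \<bullet> g x) - \<psi> x * \<sigma> n x * (X x \<bullet> k x)" for x
        by (simp add: inner_add_right inner_diff_right algebra_simps)
      ultimately show ?thesis
        using set_integral_diff(2)[OF i1[of n] i2[of n]] by simp
    qed
    have lim1: "(\<lambda>n. LINT x:\<Omega>|lborel. \<theta> n x * (X x \<bullet> g x)) \<longlonglongrightarrow> (LINT x:\<Omega>|lborel. X x \<bullet> g x)"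
      unfolding set_lebesgue_integral_def
    proof (rule integral_dominated_convergence[where w = "\<lambda>x. norm (indicator \<Omega> x *\<^sub>R (X x \<bullet> g x))"])
      show "integrable lborel (\<lambda>x. norm (indicator \<Omega> x *\<^sub>R (X x \<bullet> g x)))"
        using i3 unfolding set_integrable_def by (rule integrable_norm)
      show "AE x in lborel. norm (indicator \<Omega> x *\<^sub>R (\<theta> n x * (X x \<bullet> g x)))
          \<le> norm (indicator \<Omega> x *\<^sub>R (X x \<bullet> g x))" for n
        using \<theta>b[of n] by (intro AE_I2) (auto simp: indicator_def abs_mult mult_left_le_one_le)
      show "AE x in lborel. (\<lambda>n. indicator \<Omega> x *\<^sub>R (\<theta> n x * (X x \<bullet> g x)))
          \<longlonglongrightarrow> indicator \<Omega> x *\<^sub>R (X x \<bullet> g x)"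
      proof (rule AE_I2)
        fix x
        show "(\<lambda>n. indicator \<Omega> x *\<^sub>R (\<theta> n x * (X x \<bullet> g x))) \<longlonglongrightarrow> indicator \<Omega> x *\<^sub>R (X x \<bullet> g x)"
        proof (cases "x \<in> \<Omega> \<and> x \<in> cball p r")
          case True
          then have "\<rho> x < 0" using below rU by blast
          obtain N where N: "2 / (- \<rho> x) < real N" using reals_Archimedean2 by blast
          have "\<theta> n x = 1" if "n \<ge> N" for n
          proof -
            have "2 / (- \<rho> x) \<le> real (Suc n)" using N that by simp
            then have "2 \<le> real (Suc n) * (- \<rho> x)" using \<open>\<rho> x < 0\<close> by (simp only: pos_divide_le_eq neg_0_less_iff_less)
            then have "1 \<le> - real (Suc n) * \<rho> x - 1" by (simp del: of_nat_Suc)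
            then show ?thesis unfolding \<theta>_def by (rule smooth_step_eq)
          qed
          then have "eventually (\<lambda>n. indicator \<Omega> x *\<^sub>R (\<theta> n x * (X x \<bullet> g x)) = indicator \<Omega> x *\<^sub>R (X x \<bullet> g x)) sequentially"
            unfolding eventually_sequentially by (intro exI[of _ N]) simp
          then show ?thesis by (rule tendsto_eventually)
        qed (use g0 in auto)
      qed
      show "(\<lambda>x. indicator \<Omega> x *\<^sub>R (X x \<bullet> g x)) \<in> borel_measurable lborel"
        using i3 unfolding set_integrable_def by (rule borel_measurable_integrable)
      show "(\<lambda>x. indicator \<Omega> x *\<^sub>R (\<theta> n x * (X x \<bullet> g x))) \<in> borel_measurable lborel" for n
        using i1 unfolding set_integrable_def by (rule borel_measurable_integrable)
    qed
    have lim2: "(\<lambda>n. LINT x:\<Omega>|lborel. \<psi> x * \<sigma> n x * (X x \<bullet> k x)) \<longlonglongrightarrow> 0"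
    proof (rule LIMSEQ_I)
      fix \<eta> :: real assume "\<eta> > 0"
      define \<kappa> where "\<kappa> = \<eta> / (2 * (P * C + 1))"
      have PC: "P * C \<ge> 0" using P0 C0 by simp
      have \<kappa>: "\<kappa> > 0" using \<open>\<eta> > 0\<close> PC by (simp add: \<kappa>_def)
      \<comment> \<open>in the closure \<open>\<rho> \<ge> 0\<close> happens only on the frontier, where \<open>X\<close> is tangential\<close>
      have "X x \<bullet> k x = 0" if "x \<in> K" "0 \<le> \<rho> x" for x
      proof -
        have "x \<in> U" "x \<in> closure \<Omega>" using that K by auto
        moreover have "x \<notin> \<Omega>"
        proof
          assume "x \<in> \<Omega>"
          then have "x \<in> {x \<in> U. \<rho> x < 0}" using below \<open>x \<in> U\<close> by blast
          then show False using that by simp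
        qed
        ultimately show ?thesis using normal \<Omega>(2) by (simp add: frontier_def k_def interior_open)
      qed
      then obtain d where "d > 0" and d: "\<And>x. x \<in> K \<Longrightarrow> - d < \<rho> x \<Longrightarrow> \<bar>X x \<bullet> k x\<bar> < \<kappa>"
        using small_near_zero_level[OF K(1) continuous_on_inner[OF cX ck] c\<rho> _ \<kappa>] by blast
      obtain N where N: "2 / d < real N" using reals_Archimedean2 by blast
      show "\<exists>no. \<forall>n\<ge>no. norm ((LINT x:\<Omega>|lborel. \<psi> x * \<sigma> n x * (X x \<bullet> k x)) - 0) < \<eta>"
      proof (intro exI[of _ N] allI impI)
        fix n assume "n \<ge> N"
        have bd: "\<bar>indicator \<Omega> x *\<^sub>R (\<psi> x * \<sigma> n x * (X x \<bullet> k x))\<bar> \<le> (P * \<kappa>) * (\<zeta> x * \<sigma> n x)" for x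
        proof (cases "x \<in> \<Omega> \<and> x \<in> cball p r \<and> \<sigma> n x \<noteq> 0")
          case True
          have xK: "x \<in> K" using True closure_subset[of \<Omega>] by (auto simp: K_def)
          \<comment> \<open>where the derivative of the step does not vanish, \<open>x\<close> lies in the layer\<close>
          have "- real (Suc n) * \<rho> x - 1 < 1"
            using True smooth_step'_eq_0[of "- real (Suc n) * \<rho> x - 1"]
            unfolding \<sigma>_def by (metis mult_zero_right not_less)
          then have "- \<rho> x < 2 / real (Suc n)" by (simp add: field_simps)
          also have "\<dots> \<le> d"
          proof -
            have "2 / d \<le> real (Suc n)" using N \<open>n \<ge> N\<close> by simp
            then show ?thesis using \<open>d > 0\<close> by (simp add: field_simps)
          qed
          finally have "\<bar>X x \<bullet> k x\<bar> \<le> \<kappa>" using d[OF xK] by simp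
          then have "\<bar>\<psi> x\<bar> * \<sigma> n x * \<bar>X x \<bullet> k x\<bar> \<le> P * \<sigma> n x * \<kappa>"
            using P P0 \<sigma>0 \<kappa> by (intro mult_mono) auto
          then show ?thesis using True \<zeta>(3) \<sigma>0 by (simp add: abs_mult mult_ac)
        next
          case False
          then have 0: "indicator \<Omega> x *\<^sub>R (\<psi> x * \<sigma> n x * (X x \<bullet> k x)) = 0" using \<psi>0 by auto
          show ?thesis unfolding 0 using P0 \<kappa> \<zeta>(2)[of x] \<sigma>0[of n x] by simp
        qed
        have "\<bar>LINT x:\<Omega>|lborel. \<psi> x * \<sigma> n x * (X x \<bullet> k x)\<bar> \<le> (\<integral>x. (P * \<kappa>) * (\<zeta> x * \<sigma> n x) \<partial>lborel)"
          unfolding set_lebesgue_integral_def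
          using i2[of n] layer(1)[of n] bd unfolding set_integrable_def
          by (intro Bochner_Integration.integral_abs_bound_integral) auto
        also have "\<dots> \<le> (P * \<kappa>) * C"
          using layer(2)[of n] P0 \<kappa> by (simp add: mult_left_mono)
        also have "\<dots> = \<kappa> * (P * C)" by simp
        also have "\<dots> \<le> \<kappa> * (P * C + 1)" using \<kappa> by (intro mult_left_mono) auto
        also have "\<dots> = \<eta> / 2" using PC by (simp add: \<kappa>_def field_simps)
        also have "\<dots> < \<eta>" using \<open>\<eta> > 0\<close> by simp
        finally show "norm ((LINT x:\<Omega>|lborel. \<psi> x * \<sigma> n x * (X x \<bullet> k x)) - 0) < \<eta>" by simp
      qed
    qed
    show "(LINT x:\<Omega>|lborel. X x \<bullet> g x) = 0"
      using LIMSEQ_unique[OF lim1] lim2 by (simp add: id)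
  qed
qed

text \<open>The statement is linear in \<open>\<psi>\<close>, so a finite cover of the closure by good balls suffices.
  Rather than normalising a partition of unity, one bump \<open>b\<close> is split off at a time:
  \<open>\<psi> = b \<psi> + (1 - b) \<psi>\<close>, where the second summand vanishes on one more ball.\<close>

lemma divergence_free_up_to_boundary:
  fixes X :: "real^3 \<Rightarrow> real^3"
  assumes bdd: "bounded \<Omega>" and dom: "smooth_domain \<Omega>"
    and X: "continuous_on (closure \<Omega>) X" "divergence_free_on \<Omega> X"
    and normal: "\<And>x U \<rho>. x \<in> frontier \<Omega> \<Longrightarrow> local_defining_function \<Omega> x U \<rho> \<Longrightarrow> X x \<bullet> grad \<rho> x = 0"
    and \<psi>: "C1_on UNIV \<psi> g"
  shows "(LINT x:\<Omega>|lborel. X x \<bullet> g x) = 0"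
proof -
  have op: "open \<Omega>" using dom by (simp add: smooth_domain_def)
  define good where "good p r \<longleftrightarrow> (\<forall>\<psi> g. C1_on UNIV \<psi> g \<longrightarrow> (\<forall>x. x \<notin> cball p r \<longrightarrow> \<psi> x = 0) \<longrightarrow>
    (LINT x:\<Omega>|lborel. X x \<bullet> g x) = 0)" for p r
  have "\<exists>r>0. good p r" if "p \<in> closure \<Omega>" for p
  proof (cases "p \<in> \<Omega>")
    case True
    then obtain r where "r > 0" "cball p r \<subseteq> \<Omega>" using op open_contains_cball by blast
    moreover have "good p r"
      using X(2) compact_cball[of p r] \<open>cball p r \<subseteq> \<Omega>\<close> unfolding divergence_free_on_def good_def by blast
    ultimately show ?thesis by blast
  next
    case False
    then have "p \<in> frontier \<Omega>" using that op by (simp add: frontier_def interior_open)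
    then obtain U \<rho> where \<rho>: "local_defining_function \<Omega> p U \<rho>" using dom by (auto simp: smooth_domain_def)
    have "X x \<bullet> grad \<rho> x = 0" if "x \<in> frontier \<Omega> \<inter> U" for x
    proof (rule normal)
      show "local_defining_function \<Omega> x U \<rho>"
        using that \<rho> unfolding local_defining_function_def by blast
    qed (use that in blast)
    from divergence_free_up_to_boundary_local[OF bdd op X \<rho> this] obtain r where "r > 0"
      "\<And>\<psi> g. C1_on UNIV \<psi> g \<Longrightarrow> (\<And>x. x \<notin> cball p r \<Longrightarrow> \<psi> x = 0) \<Longrightarrow>
        (LINT x:\<Omega>|lborel. X x \<bullet> g x) = 0" by blast
    then show ?thesis unfolding good_def by blast
  qed
  then obtain r where r: "\<And>p. p \<in> closure \<Omega> \<Longrightarrow> r p > 0" "\<And>p. p \<in> closure \<Omega> \<Longrightarrow> good p (r p)"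
    by metis
  have "closure \<Omega> \<subseteq> (\<Union>p\<in>closure \<Omega>. ball p (r p / 2))" using r(1) by fastforce
  moreover have "compact (closure \<Omega>)" using bdd by (simp add: compact_closure)
  ultimately obtain F where F: "F \<subseteq> closure \<Omega>" "finite F" "closure \<Omega> \<subseteq> (\<Union>p\<in>F. ball p (r p / 2))"
    using compactE_image[of "closure \<Omega>" "closure \<Omega>" "\<lambda>p. ball p (r p / 2)"] by auto
  have int: "set_integrable lborel \<Omega> (\<lambda>x. X x \<bullet> h x)" if "C1_on UNIV f h" for f h
    by (rule continuous_closure_set_integrable[OF bdd op])
      (use X(1) C1_on_continuous_gradient[OF that] in \<open>auto intro!: continuous_intros intro: continuous_on_subset\<close>)
  have "(LINT x:\<Omega>|lborel. X x \<bullet> g x) = 0"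
    if "finite F" "F \<subseteq> closure \<Omega>" "C1_on UNIV \<psi> g"
      "\<And>x. x \<in> \<Omega> \<Longrightarrow> x \<notin> (\<Union>p\<in>F. ball p (r p / 2)) \<Longrightarrow> \<psi> x = 0" for F \<psi> g
    using that
  proof (induction F arbitrary: \<psi> g rule: finite_induct)
    case empty
    have "g x = 0" if "x \<in> \<Omega>" for x
      using C1_on_gradient_eq_0[OF empty(2) op that] empty(3) by auto
    then have "(LINT x:\<Omega>|lborel. X x \<bullet> g x) = (LINT x:\<Omega>|lborel. 0)"
      using op by (intro set_lebesgue_integral_cong) auto
    then show ?case by (simp add: set_lebesgue_integral_def)
  next
    case (insert p F)
    have p: "p \<in> closure \<Omega>" using insert.prems(1) by blast
    have "r p / 2 > 0" using r(1)[OF p] by simp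
    then obtain b h where b: "C1_on UNIV b h" "\<And>x. 0 \<le> b x"
      "\<And>x. x \<in> cball p (r p / 2) \<Longrightarrow> b x = 1" "\<And>x. x \<notin> cball p (2 * (r p / 2)) \<Longrightarrow> b x = 0"
      by (rule C1_on_bump[where p = p]) (rule that)
    have 1: "C1_on UNIV (\<lambda>x. b x * \<psi> x) (\<lambda>x. b x *\<^sub>R g x + \<psi> x *\<^sub>R h x)"
      by (rule C1_on_mult[OF b(1) insert.prems(2)])
    have 2: "C1_on UNIV (\<lambda>x. (1 + (- 1) * b x) * \<psi> x)
        (\<lambda>x. (1 + (- 1) * b x) *\<^sub>R g x + \<psi> x *\<^sub>R (0 + ((- 1) *\<^sub>R h x + b x *\<^sub>R 0)))"
      by (rule C1_on_mult C1_on_add C1_on_const b(1) insert.prems(2))+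
    have "(LINT x:\<Omega>|lborel. X x \<bullet> (b x *\<^sub>R g x + \<psi> x *\<^sub>R h x)) = 0"
      using r(2)[OF p] 1 b(4) unfolding good_def by simp
    moreover have "(LINT x:\<Omega>|lborel. X x \<bullet> ((1 + (- 1) * b x) *\<^sub>R g x + \<psi> x *\<^sub>R (0 + ((- 1) *\<^sub>R h x + b x *\<^sub>R 0)))) = 0"
    proof (rule insert.IH[OF _ 2])
      fix x assume x: "x \<in> \<Omega>" "x \<notin> (\<Union>p\<in>F. ball p (r p / 2))"
      show "(1 + (- 1) * b x) * \<psi> x = 0"
        using b(3)[of x] insert.prems(3)[of x] x by (cases "x \<in> ball p (r p / 2)") auto
    qed (use insert.prems(1) in auto)
    moreover have "X x \<bullet> g x = X x \<bullet> (b x *\<^sub>R g x + \<psi> x *\<^sub>R h x) +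
        X x \<bullet> ((1 + (- 1) * b x) *\<^sub>R g x + \<psi> x *\<^sub>R (0 + ((- 1) *\<^sub>R h x + b x *\<^sub>R 0)))" for x
      by (simp add: inner_add_right inner_diff_right algebra_simps)
    ultimately show ?case
      using set_integral_add(2)[OF int[OF 1] int[OF 2]] by simp
  qed
  from this[OF F(2,1) \<psi>] show ?thesis using F(3) closure_subset[of \<Omega>] by blast
qed

section \<open>The stress field and the Pohozaev identity\<close>

lemma integral_lebesgue_on_eq_lborel:
  fixes f :: "'a::euclidean_space \<Rightarrow> real"
  assumes "open \<Omega>" "(\<lambda>x. indicator \<Omega> x *\<^sub>R f x) \<in> borel_measurable borel"
  shows "(\<integral>x. f x \<partial>lebesgue_on \<Omega>) = (\<integral>x. indicator \<Omega> x *\<^sub>R f x \<partial>lborel)"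
proof -
  have "(\<integral>x. f x \<partial>lebesgue_on \<Omega>) = (\<integral>x. indicator \<Omega> x *\<^sub>R f x \<partial>lebesgue)"
    using assms(1) by (intro integral_restrict_space) auto
  also have "\<dots> = (\<integral>x. indicator \<Omega> x *\<^sub>R f x \<partial>lborel)"
    using assms(2) by (intro integral_completion) simp
  finally show ?thesis .
qed

text \<open>The weak Jacobian serves only as an intermediary here. Its symmetry gives the curl equation, its
  trace the divergence equation. The trace requires summing integrals, hence the integrability of
  \<open>D\<close> against a bounded function on a set of finite measure.\<close>

lemma harmonic_neumann_field_weakly_curl_div_free:
  assumes bdd: "bounded \<Omega>" and op: "open \<Omega>" and \<Gamma>: "\<Gamma> \<in> harmonic_neumann_fields \<Omega>"
  shows "weakly_curl_div_free \<Omega> (zero_extension \<Omega> \<Gamma>)"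
  unfolding weakly_curl_div_free_def
proof (intro allI impI)
  fix \<phi> p assume \<phi>: "\<phi> \<in> test_functions \<Omega>" and p: "C1_on UNIV \<phi> p"
  let ?L = "lebesgue_on \<Omega>"
  have cont: "continuous_on (closure \<Omega>) \<Gamma>" using \<Gamma> by (simp add: harmonic_neumann_fields_def)
  obtain D where D: "has_weak_jacobian \<Omega> \<Gamma> D"
    using \<Gamma> by (auto simp: harmonic_neumann_fields_def H1_def)
  then have AE_curl: "AE x in ?L. jacobian_curl (D x) = 0" and AE_div: "AE x in ?L. trace (D x) = 0"
    using \<Gamma> by (auto simp: harmonic_neumann_fields_def curl_vanishes_def div_vanishes_def)
  have Dm: "D \<in> borel_measurable ?L" and D2: "integrable ?L (\<lambda>x. (norm (D x))\<^sup>2)"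
    using D by (auto simp: has_weak_jacobian_def square_integrable_on_def)
  have Dij: "(\<lambda>x. D x $ i $ j) \<in> borel_measurable ?L" for i j
  proof -
    have "(\<lambda>A::real^3^3. A $ i $ j) \<in> borel_measurable borel"
      by (intro borel_measurable_continuous_onI continuous_intros)
    from measurable_compose[OF Dm this] show ?thesis .
  qed
  have "continuous_on \<Omega> \<phi>" using C1_on_continuous[OF p] continuous_on_subset by blast
  then have \<phi>m: "\<phi> \<in> borel_measurable ?L"
    using op by (intro continuous_imp_measurable_on_sets_lebesgue) auto
  have Dm': "(\<lambda>x. D x $ i $ j * \<phi> x) \<in> borel_measurable ?L" for i j
    using Dij \<phi>m by (rule borel_measurable_times)
  have pd: "partial_deriv j \<phi> x = p x $ j" for j x
    by (simp add: partial_deriv_def inner_axis frechet_derivative_at[OF C1_onD[OF p UNIV_I], symmetric])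
  have weak: "(\<integral>y. zero_extension \<Omega> \<Gamma> y $ i * p y $ j \<partial>lborel) = - (\<integral>x. D x $ i $ j * \<phi> x \<partial>?L)" for i j
  proof -
    have pm: "(\<lambda>x. p x $ j) \<in> borel_measurable borel"
      using C1_on_continuous_gradient[OF p] by (intro borel_measurable_continuous_onI continuous_intros)
    have Gm: "(\<lambda>x. zero_extension \<Omega> \<Gamma> x $ i) \<in> borel_measurable borel"
      using borel_measurable_integrable[OF zero_extension_integrable[OF bdd op cont, of i]] by simp
    have eq: "(\<lambda>x. indicator \<Omega> x *\<^sub>R (\<Gamma> x $ i * p x $ j)) = (\<lambda>x. zero_extension \<Omega> \<Gamma> x $ i * p x $ j)"
      by (simp add: zero_extension_def fun_eq_iff)
    have "(\<integral>x. \<Gamma> x $ i * p x $ j \<partial>?L) = - (\<integral>x. D x $ i $ j * \<phi> x \<partial>?L)"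
      using D \<phi> unfolding has_weak_jacobian_def pd[symmetric] by blast
    moreover have "(\<integral>x. \<Gamma> x $ i * p x $ j \<partial>?L) = (\<integral>x. zero_extension \<Omega> \<Gamma> x $ i * p x $ j \<partial>lborel)"
      using integral_lebesgue_on_eq_lborel[OF op, of "\<lambda>x. \<Gamma> x $ i * p x $ j"] pm Gm
      unfolding eq by simp
    ultimately show ?thesis by simp
  qed
  have sym: "(\<integral>x. D x $ i $ j * \<phi> x \<partial>?L) = (\<integral>x. D x $ j $ i * \<phi> x \<partial>?L)" for i j
  proof (rule integral_cong_AE[OF Dm' Dm'])
    show "AE x in ?L. D x $ i $ j * \<phi> x = D x $ j $ i * \<phi> x"
      using AE_curl
    proof eventually_elim
      case (elim x)
      then have "D x $ 3 $ 2 = D x $ 2 $ 3" "D x $ 1 $ 3 = D x $ 3 $ 1" "D x $ 2 $ 1 = D x $ 1 $ 2"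
        by (simp_all add: jacobian_curl_def vec_eq_iff forall_3 vector_3)
      then have "D x $ i $ j = D x $ j $ i"
        using exhaust_3[of i] exhaust_3[of j] by auto
      then show ?case by simp
    qed
  qed
  obtain S where S: "compact S" "\<And>x. x \<notin> S \<Longrightarrow> \<phi> x = 0"
  proof (rule that[of "closure {x. \<phi> x \<noteq> 0}"])
    show "\<phi> x = 0" if "x \<notin> closure {x. \<phi> x \<noteq> 0}" for x
      using that closure_subset[of "{x. \<phi> x \<noteq> 0}"] by blast
  qed (use \<phi> in \<open>simp add: test_functions_def\<close>)
  obtain P where P: "\<And>x. \<bar>\<phi> x\<bar> \<le> P"
    using compact_support_bounded[OF C1_on_continuous[OF p] S] by auto
  have P0: "P \<ge> 0" using P[of 0] by linarith
  have "\<Omega> \<in> lmeasurable" using bdd op by (intro bounded_set_imp_lmeasurable) auto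
  then interpret finite_measure ?L by (rule finite_measure_lebesgue_on)
  have Dint: "integrable ?L (\<lambda>x. D x $ i $ j * \<phi> x)" for i j
  proof (rule Bochner_Integration.integrable_bound)
    show "integrable ?L (\<lambda>x. (1 + (norm (D x))\<^sup>2) * P)" using D2 by auto
    show "AE x in ?L. norm (D x $ i $ j * \<phi> x) \<le> norm ((1 + (norm (D x))\<^sup>2) * P)"
    proof (rule AE_I2)
      fix x
      have "\<bar>D x $ i $ j\<bar> \<le> norm (D x)"
        using component_le_norm_cart[of "D x $ i" j] Finite_Cartesian_Product.norm_nth_le[of "D x" i] by linarith
      also have "\<dots> \<le> 1 + (norm (D x))\<^sup>2"
        using sum_squares_bound[of "norm (D x)" 1] by (simp add: power2_eq_square) (smt (verit) norm_ge_zero)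
      finally have "\<bar>D x $ i $ j\<bar> * \<bar>\<phi> x\<bar> \<le> (1 + (norm (D x))\<^sup>2) * P"
        using P by (intro mult_mono) auto
      then show "norm (D x $ i $ j * \<phi> x) \<le> norm ((1 + (norm (D x))\<^sup>2) * P)"
        using P0 by (simp add: abs_mult)
    qed
  qed (rule Dm')
  have "(\<Sum>i\<in>UNIV. \<integral>x. D x $ i $ i * \<phi> x \<partial>?L) = (\<integral>x. (\<Sum>i\<in>UNIV. D x $ i $ i * \<phi> x) \<partial>?L)"
    using Dint by (intro Bochner_Integration.integral_sum[symmetric])
  also have "\<dots> = (\<integral>x. 0 \<partial>?L)"
  proof (rule integral_cong_AE)
    show "AE x in ?L. (\<Sum>i\<in>UNIV. D x $ i $ i * \<phi> x) = 0"
      using AE_div by eventually_elim (simp add: trace_def flip: sum_distrib_right)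
  qed (use Dm' in \<open>auto intro: borel_measurable_sum\<close>)
  finally have tr: "(\<Sum>i\<in>UNIV. \<integral>x. D x $ i $ i * \<phi> x \<partial>?L) = 0" by simp
  show "(\<forall>i j. (\<integral>y. zero_extension \<Omega> \<Gamma> y $ i * p y $ j \<partial>lborel) =
        (\<integral>y. zero_extension \<Omega> \<Gamma> y $ j * p y $ i \<partial>lborel)) \<and>
      (\<Sum>i\<in>UNIV. \<integral>y. zero_extension \<Omega> \<Gamma> y $ i * p y $ i \<partial>lborel) = 0"
    unfolding weak using sym tr by (simp add: sum_negf)
qed

text \<open>The Maxwell stress tensor of the field value \<open>v\<close>, up to sign, applied to the vector \<open>a\<close>.\<close>

definition stress :: "real^3 \<Rightarrow> real^3 \<Rightarrow> real^3" where
  "stress a v = ((norm v)\<^sup>2 / 2) *\<^sub>R a - (v \<bullet> a) *\<^sub>R v"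

lemma continuous_on_stress [continuous_intros]:
  "continuous_on S f \<Longrightarrow> continuous_on S (\<lambda>x. stress a (f x))"
  unfolding stress_def by (intro continuous_intros) auto

text \<open>The product rule gives
  \<open>div (stress a V) = V \<bullet> (DV a) - a \<bullet> (DV V) - (V \<bullet> a) div V\<close>, where \<open>DV\<close> has the rows \<open>W i\<close>;
  the first two terms cancel for symmetric \<open>DV\<close>, the last one for trace zero.\<close>

lemma divergence_stress_eq_0:
  fixes V :: "real^3 \<Rightarrow> real^3"
  assumes V: "\<And>i. C1_on UNIV (\<lambda>x. V x $ i) (W i)"
  shows "\<exists>H. (\<forall>i. C1_on UNIV (\<lambda>x. stress a (V x) $ i) (H i)) \<and>
    (\<forall>x. (\<forall>i j. W i x $ j = W j x $ i) \<longrightarrow> (\<Sum>i\<in>UNIV. W i x $ i) = 0 \<longrightarrow> (\<Sum>i\<in>UNIV. H i x $ i) = 0)"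
proof -
  let ?A = "\<lambda>x. \<Sum>k\<in>UNIV. V x $ k * V x $ k" and ?gA = "\<lambda>x. \<Sum>k\<in>UNIV. V x $ k *\<^sub>R W k x + V x $ k *\<^sub>R W k x"
  let ?B = "\<lambda>x. \<Sum>k\<in>UNIV. a $ k * V x $ k" and ?gB = "\<lambda>x. \<Sum>k\<in>UNIV. a $ k *\<^sub>R W k x + V x $ k *\<^sub>R 0"
  define H where "H i x = (a $ i / 2) *\<^sub>R ?gA x + ?A x *\<^sub>R 0 +
    ((-1) *\<^sub>R (?B x *\<^sub>R W i x + V x $ i *\<^sub>R ?gB x) + (?B x * V x $ i) *\<^sub>R 0)" for i x
  show ?thesis
  proof (intro exI[of _ H] conjI allI impI)
    have eq: "stress a (V x) $ i = (a $ i / 2) * ?A x + (-1) * (?B x * V x $ i)" for i x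
      by (simp add: stress_def power2_norm_eq_inner inner_vec_def mult.commute)
    show "C1_on UNIV (\<lambda>x. stress a (V x) $ i) (H i)" for i
      unfolding eq H_def[abs_def] by (rule C1_on_add C1_on_mult C1_on_const C1_on_sum V)+
    fix x assume "\<forall>i j. W i x $ j = W j x $ i" and tr: "(\<Sum>i\<in>UNIV. W i x $ i) = 0"
    then have sym: "\<And>i j. W i x $ j = W j x $ i" by blast
    have t: "W 3 x $ 3 = - W 1 x $ 1 - W 2 x $ 2" using tr by (simp add: sum_3)
    show "(\<Sum>i\<in>UNIV. H i x $ i) = 0"
      by (simp add: H_def sum_3 t sym[of 2 1] sym[of 3 1] sym[of 3 2] algebra_simps)
  qed
qed

text \<open>Integration by parts: \<open>Y \<bullet> g\<close> is the divergence of \<open>\<psi> Y\<close> wherever \<open>div Y = 0\<close>.\<close>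

lemma integral_against_gradient:
  fixes Y :: "real^3 \<Rightarrow> real^3"
  assumes Y: "\<And>i. C1_on UNIV (\<lambda>x. Y x $ i) (H i)"
    and \<psi>: "C1_on UNIV \<psi> g" and S: "compact S" "\<And>x. x \<notin> S \<Longrightarrow> \<psi> x = 0"
    and div: "\<And>x. x \<in> S \<Longrightarrow> (\<Sum>i\<in>UNIV. H i x $ i) = 0"
  shows "(\<integral>x. Y x \<bullet> g x \<partial>lborel) = 0"
proof -
  have g0: "x \<notin> S \<Longrightarrow> g x = 0" for x
    using C1_gradient_support[OF \<psi> compact_imp_closed[OF S(1)] S(2)] by blast
  have P: "C1_on UNIV (\<lambda>x. Y x $ i * \<psi> x) (\<lambda>x. Y x $ i *\<^sub>R g x + \<psi> x *\<^sub>R H i x)" for i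
    by (rule C1_on_mult[OF Y \<psi>])
  have int: "integrable lborel (\<lambda>x. (Y x $ i *\<^sub>R g x + \<psi> x *\<^sub>R H i x) \<bullet> axis i 1)" for i
    by (rule compact_support_integrable[OF _ S(1)])
      (use C1_on_continuous_gradient[OF P] g0 S(2) in \<open>auto intro!: continuous_on_inner\<close>)
  have "Y x \<bullet> g x = (\<Sum>i\<in>UNIV. (Y x $ i *\<^sub>R g x + \<psi> x *\<^sub>R H i x) \<bullet> axis i 1)" for x
  proof -
    have "(\<Sum>i\<in>UNIV. (Y x $ i *\<^sub>R g x + \<psi> x *\<^sub>R H i x) \<bullet> axis i 1) =
        Y x \<bullet> g x + \<psi> x * (\<Sum>i\<in>UNIV. H i x $ i)"
      by (simp add: inner_axis sum.distrib sum_distrib_left) (simp add: inner_vec_def)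
    moreover have "\<psi> x * (\<Sum>i\<in>UNIV. H i x $ i) = 0" using div[of x] S(2)[of x] by (cases "x \<in> S") auto
    ultimately show ?thesis by simp
  qed
  then have "(\<integral>x. Y x \<bullet> g x \<partial>lborel) =
      (\<Sum>i\<in>UNIV. \<integral>x. (Y x $ i *\<^sub>R g x + \<psi> x *\<^sub>R H i x) \<bullet> axis i 1 \<partial>lborel)"
    using int by simp
  also have "\<dots> = 0"
    by (rule sum.neutral) (use integral_gradient_eq_0[OF P S(1)] S(2) in simp)
  finally show ?thesis .
qed

text \<open>For the mollified field this is a pointwise identity; the stress depends continuously on the
  field, so the integral against a fixed compactly supported gradient passes to the limit. The constant
  field \<open>c a\<close> contributes nothing.\<close>

lemma stress_divergence_free:
  fixes \<Gamma> :: "real^3 \<Rightarrow> real^3"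
  assumes \<Omega>: "bounded \<Omega>" "open \<Omega>" and cont: "continuous_on (closure \<Omega>) \<Gamma>"
    and weak: "weakly_curl_div_free \<Omega> (zero_extension \<Omega> \<Gamma>)"
  shows "divergence_free_on \<Omega> (\<lambda>x. stress a (\<Gamma> x) - c *\<^sub>R a)"
  unfolding divergence_free_on_def
proof (intro allI impI)
  fix \<psi> g S assume \<psi>: "C1_on UNIV \<psi> g" and S: "compact S" "S \<subseteq> \<Omega>" and "\<forall>x. x \<notin> S \<longrightarrow> \<psi> x = 0"
  then have \<psi>0: "\<And>x. x \<notin> S \<Longrightarrow> \<psi> x = 0" by blast
  have g0: "x \<notin> S \<Longrightarrow> g x = 0" for x
    using C1_gradient_support[OF \<psi> compact_imp_closed[OF S(1)] \<psi>0] by blast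
  have gc: "continuous_on UNIV g" by (rule C1_on_continuous_gradient[OF \<psi>])
  let ?G = "zero_extension \<Omega> \<Gamma>"
  have ia: "integrable lborel (\<lambda>x. g x \<bullet> a)"
    by (rule compact_support_integrable[OF _ S(1)]) (use gc g0 in \<open>auto intro!: continuous_intros\<close>)
  have c\<Gamma>: "continuous_on S \<Gamma>" using cont S(2) closure_subset by (blast intro: continuous_on_subset)
  have isg: "integrable lborel (\<lambda>x. stress a (\<Gamma> x) \<bullet> g x)"
    by (rule integrable_continuous_on_support[OF S(1)])
      (use g0 gc in \<open>auto intro!: continuous_intros c\<Gamma> intro: continuous_on_subset\<close>)
  have main: "(\<integral>x. stress a (\<Gamma> x) \<bullet> g x \<partial>lborel) = 0"
  proof (rule ccontr)
    define I where "I = (\<integral>x. stress a (\<Gamma> x) \<bullet> g x \<partial>lborel)"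
    define m where "m = (\<integral>x. norm (g x) \<partial>lborel)"
    have m: "m \<ge> 0" by (simp add: m_def)
    assume "(\<integral>x. stress a (\<Gamma> x) \<bullet> g x \<partial>lborel) \<noteq> 0"
    then have I: "\<bar>I\<bar> > 0" by (simp add: I_def)
    obtain M where M: "\<And>x. x \<in> S \<Longrightarrow> norm (\<Gamma> x) \<le> M"
      using compact_imp_bounded[OF compact_continuous_image[OF c\<Gamma> S(1)]] by (auto simp: bounded_iff)
    define \<eta> where "\<eta> = \<bar>I\<bar> / (2 * (m + 1))"
    have \<eta>: "\<eta> > 0" using I m by (simp add: \<eta>_def)
    \<comment> \<open>the ball contains the values of \<open>\<Gamma>\<close> on \<open>S\<close> and those of any field within distance 1\<close>
    have "uniformly_continuous_on (cball 0 (M + 1)) (stress a)"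
      by (rule compact_uniformly_continuous) (auto intro!: continuous_intros)
    then obtain d where "d > 0" and d: "\<And>v w. v \<in> cball 0 (M + 1) \<Longrightarrow> w \<in> cball 0 (M + 1) \<Longrightarrow>
        dist w v < d \<Longrightarrow> dist (stress a w) (stress a v) < \<eta>"
      using \<eta> unfolding uniformly_continuous_on_def by metis
    have d1: "min (d / 2) 1 > 0" using \<open>d > 0\<close> by simp
    obtain \<epsilon> where \<epsilon>: "\<epsilon> > 0" and sub: "\<And>x. x \<in> S \<Longrightarrow> cball x \<epsilon> \<subseteq> \<Omega>"
      and close: "\<And>x. x \<in> S \<Longrightarrow> norm (mollified \<epsilon> ?G x - \<Gamma> x) \<le> min (d / 2) 1"
      by (rule mollified_converges[OF \<Omega> cont S d1]) (rule that)
    note Gi = zero_extension_integrable[OF \<Omega> cont]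
    let ?V = "mollified \<epsilon> ?G"
    obtain H where H: "\<And>i. C1_on UNIV (\<lambda>x. stress a (?V x) $ i) (H i)" and
      Hdiv: "\<And>x. (\<forall>i j. mollified_gradient \<epsilon> ?G i x $ j = mollified_gradient \<epsilon> ?G j x $ i) \<Longrightarrow>
        (\<Sum>i\<in>UNIV. mollified_gradient \<epsilon> ?G i x $ i) = 0 \<Longrightarrow> (\<Sum>i\<in>UNIV. H i x $ i) = 0"
      using divergence_stress_eq_0[of ?V "mollified_gradient \<epsilon> ?G" a, OF C1_mollified[OF \<epsilon> Gi]] by blast
    have V0: "(\<integral>x. stress a (?V x) \<bullet> g x \<partial>lborel) = 0"
      by (rule integral_against_gradient[OF H \<psi> S(1) \<psi>0 Hdiv])
        (use mollified_curl_div_free[OF \<epsilon> Gi weak sub] in auto)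
    have cV: "continuous_on UNIV ?V"
    proof -
      have "continuous_on UNIV (\<lambda>x. \<chi> i. ?V x $ i)"
        by (intro continuous_on_vec_lambda C1_on_continuous[OF C1_mollified[OF \<epsilon> Gi]])
      then show ?thesis by simp
    qed
    have iV: "integrable lborel (\<lambda>x. stress a (?V x) \<bullet> g x)"
      by (rule compact_support_integrable[OF _ S(1)]) (use g0 gc cV in \<open>auto intro!: continuous_intros\<close>)
    have "I = (\<integral>x. stress a (\<Gamma> x) \<bullet> g x - stress a (?V x) \<bullet> g x \<partial>lborel)"
      using isg iV V0 by (simp add: I_def)
    also have "\<bar>\<dots>\<bar> \<le> (\<integral>x. \<eta> * norm (g x) \<partial>lborel)"
    proof (rule Bochner_Integration.integral_abs_bound_integral)
      show "integrable lborel (\<lambda>x. \<eta> * norm (g x))"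
        using compact_support_integrable[OF gc S(1) g0] by (intro integrable_mult_right integrable_norm) auto
      fix x
      show "\<bar>stress a (\<Gamma> x) \<bullet> g x - stress a (?V x) \<bullet> g x\<bar> \<le> \<eta> * norm (g x)"
      proof (cases "x \<in> S")
        case True
        have "norm (?V x) \<le> M + 1"
          using M[OF True] close[OF True] norm_triangle_ineq2[of "?V x" "\<Gamma> x"] by simp
        then have "dist (stress a (\<Gamma> x)) (stress a (?V x)) < \<eta>"
          using M[OF True] close[OF True] \<open>d > 0\<close> by (intro d) (auto simp: dist_norm norm_minus_commute)
        then have "norm (stress a (\<Gamma> x) - stress a (?V x)) * norm (g x) \<le> \<eta> * norm (g x)"
          by (intro mult_right_mono) (auto simp: dist_norm)
        then show ?thesis
          using Cauchy_Schwarz_ineq2[of "stress a (\<Gamma> x) - stress a (?V x)" "g x"]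
          by (simp add: inner_diff_left)
      qed (simp add: g0)
    qed (use isg iV in auto)
    also have "\<dots> = \<eta> * m" by (simp add: m_def)
    also have "\<dots> < \<eta> * (2 * (m + 1))" using \<eta> m by (intro mult_strict_left_mono) auto
    also have "\<dots> = \<bar>I\<bar>" using m by (simp add: \<eta>_def)
    finally show False by simp
  qed
  have z: "indicator \<Omega> x *\<^sub>R ((stress a (\<Gamma> x) - c *\<^sub>R a) \<bullet> g x) =
      stress a (\<Gamma> x) \<bullet> g x - c * (g x \<bullet> a)" for x
  proof (cases "x \<in> S")
    case True
    then have "x \<in> \<Omega>" using S(2) by blast
    then show ?thesis by (simp add: inner_diff_left inner_commute[of a])
  qed (simp add: g0)
  show "(LINT x:\<Omega>|lborel. (stress a (\<Gamma> x) - c *\<^sub>R a) \<bullet> g x) = 0"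
    unfolding set_lebesgue_integral_def z
    using isg ia main integral_gradient_eq_0[OF \<psi> S(1) \<psi>0, of a] by simp
qed

theorem propositionA1:
  fixes \<Omega> :: "(real^3) set" and \<Gamma> :: "real^3 \<Rightarrow> real^3" and c :: real
  assumes "bounded \<Omega>" and "smooth_domain \<Omega>"
    and "\<Gamma> \<in> harmonic_neumann_fields \<Omega>"
    and "c \<ge> 0" and "\<forall>x\<in>frontier \<Omega>. (norm (\<Gamma> x))\<^sup>2 = c"
  shows "\<forall>x\<in>\<Omega>. \<Gamma> x = 0"
proof
  fix p assume p: "p \<in> \<Omega>"
  have op: "open \<Omega>" using assms(2) by (simp add: smooth_domain_def)
  have cont: "continuous_on (closure \<Omega>) \<Gamma>" and
    tangential: "\<And>x \<nu>. x \<in> frontier \<Omega> \<Longrightarrow> outward_unit_normal \<Omega> x \<nu> \<Longrightarrow> \<nu> \<bullet> \<Gamma> x = 0"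
    using assms(3) by (auto simp: harmonic_neumann_fields_def)
  note weak = harmonic_neumann_field_weakly_curl_div_free[OF assms(1) op assms(3)]
  have le: "(norm (\<Gamma> x))\<^sup>2 \<le> c" if "x \<in> \<Omega>" for x
  proof -
    have "norm (\<Gamma> x) \<le> sqrt c"
    proof (rule harmonic_field_norm_le_boundary[OF assms(1) op cont weak _ that])
      show "norm (\<Gamma> y) \<le> sqrt c" if "y \<in> frontier \<Omega>" for y
        using assms(5) that by (metis norm_ge_zero order_refl real_sqrt_abs abs_of_nonneg)
    qed
    then show ?thesis using assms(4) by (metis norm_ge_zero power_mono real_sqrt_pow2)
  qed
  have int: "set_integrable lborel \<Omega> f" if "continuous_on (closure \<Omega>) f" for f :: "real^3 \<Rightarrow> real"
    by (rule continuous_closure_set_integrable[OF assms(1) op that])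
  define e :: "3 \<Rightarrow> real^3" where "e j = axis j 1" for j
  have comp: "(LINT x:\<Omega>|lborel. (stress (e j) (\<Gamma> x) - (c / 2) *\<^sub>R e j) \<bullet> e j) = 0" for j
  proof (rule divergence_free_up_to_boundary[OF assms(1,2) _ stress_divergence_free[OF assms(1) op cont weak] _
      C1_on_inner])
    show "continuous_on (closure \<Omega>) (\<lambda>x. stress (e j) (\<Gamma> x) - (c / 2) *\<^sub>R e j)"
      by (intro continuous_intros cont)
    fix x U \<rho> assume x: "x \<in> frontier \<Omega>" and \<rho>: "local_defining_function \<Omega> x U \<rho>"
    then have "outward_unit_normal \<Omega> x (grad \<rho> x /\<^sub>R norm (grad \<rho> x))"
      by (auto simp: outward_unit_normal_def)
    moreover have "grad \<rho> x \<noteq> 0" using \<rho> by (auto simp: local_defining_function_def)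
    ultimately have "\<Gamma> x \<bullet> grad \<rho> x = 0" using tangential[OF x] by (force simp: inner_commute)
    then show "(stress (e j) (\<Gamma> x) - (c / 2) *\<^sub>R e j) \<bullet> grad \<rho> x = 0"
      using assms(5) x by (simp add: stress_def inner_diff_left)
  qed
  have "(\<Sum>j\<in>UNIV. (stress (e j) (\<Gamma> x) - (c / 2) *\<^sub>R e j) \<bullet> e j) = (norm (\<Gamma> x))\<^sup>2 / 2 - 3 / 2 * c" for x
  proof -
    have 1: "(stress (e j) (\<Gamma> x) - (c / 2) *\<^sub>R e j) \<bullet> e j = (norm (\<Gamma> x))\<^sup>2 / 2 - (\<Gamma> x $ j)\<^sup>2 - c / 2" for j
      by (simp add: stress_def inner_diff_left e_def inner_axis power2_eq_square)
    have 2: "(norm (\<Gamma> x))\<^sup>2 = (\<Gamma> x $ 1)\<^sup>2 + (\<Gamma> x $ 2)\<^sup>2 + (\<Gamma> x $ 3)\<^sup>2"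
      unfolding power2_norm_eq_inner inner_vec_def by (simp add: sum_3 power2_eq_square)
    show ?thesis unfolding sum_3 1 2 by (simp add: field_simps)
  qed
  moreover have "(LINT x:\<Omega>|lborel. (\<Sum>j\<in>UNIV. (stress (e j) (\<Gamma> x) - (c / 2) *\<^sub>R e j) \<bullet> e j)) = 0"
  proof -
    have i: "integrable lborel (\<lambda>x. indicator \<Omega> x *\<^sub>R ((stress (e j) (\<Gamma> x) - (c / 2) *\<^sub>R e j) \<bullet> e j))" for j
      unfolding set_integrable_def[symmetric] by (intro int continuous_intros cont)
    show ?thesis
      using Bochner_Integration.integral_sum[of UNIV lborel
          "\<lambda>j x. indicator \<Omega> x *\<^sub>R ((stress (e j) (\<Gamma> x) - (c / 2) *\<^sub>R e j) \<bullet> e j)", OF i] comp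
      unfolding set_lebesgue_integral_def by (simp add: scaleR_sum_right sum_distrib_left)
  qed
  ultimately have "(LINT x:\<Omega>|lborel. (norm (\<Gamma> x))\<^sup>2 / 2 - 3 / 2 * c) = 0" by simp
  \<comment> \<open>the maximum principle bounds the integrand of the Pohozaev identity by \<open>- c\<close>, forcing \<open>c \<le> 0\<close>\<close>
  moreover have "(LINT x:\<Omega>|lborel. (norm (\<Gamma> x))\<^sup>2 / 2 - 3 / 2 * c) \<le> (LINT x:\<Omega>|lborel. - c)"
  proof (rule set_integral_mono)
    show "(norm (\<Gamma> x))\<^sup>2 / 2 - 3 / 2 * c \<le> - c" if "x \<in> \<Omega>" for x using le[OF that] by simp
  qed (use cont in \<open>auto intro!: int continuous_intros\<close>)
  moreover have "(LINT x:\<Omega>|lborel. - c) = - c * measure lborel \<Omega>"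
    using op by (simp add: set_lebesgue_integral_def)
  moreover have "measure lborel \<Omega> > 0"
  proof -
    have "emeasure lborel \<Omega> \<noteq> 0"
      using open_not_negligible[OF op] p op by (auto simp: negligible_iff_emeasure0)
    moreover have "emeasure lborel \<Omega> < \<infinity>" using assms(1) by (rule emeasure_bounded_finite)
    ultimately show ?thesis by (simp add: measure_def enn2real_positive_iff zero_less_iff_neq_zero)
  qed
  ultimately have "c * measure lborel \<Omega> \<le> 0" "measure lborel \<Omega> > 0" by linarith+
  then have "c \<le> 0" by (simp add: mult_le_0_iff)
  then show "\<Gamma> p = 0" using le[OF p] zero_le_power2[of "norm (\<Gamma> p)"] by (metis norm_eq_zero order_antisym order_trans power_eq_0_iff)
qed

end
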